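(* Let $G$ be a graph of order $n \geq 2$ and $\overline{G}$ its complement. Then \[1 \leq \mathrm{pt}_+(G) + \mathrm{pt}_+(\overline{G}) \leq \frac{n}{2} + 2.\] Moreover, for every $n\ge 2$ there is a graph $G$ of order $n$ with $\mathrm{pt}_+(G) + \mathrm{pt}_+(\overline{G})=1$, and for every even $n\ge 8$ there is a graph $G$ of order $n$ with $\mathrm{pt}_+(G) + \mathrm{pt}_+(\overline{G})=\frac n2+2$.
   Context: Graphs are finite and simple; $\overline{G}$ has vertex set $V(G)$ and edges exactly the pairs of distinct non-adjacent vertices of $G$. PSD color change rule: let $B$ be the current set of blue vertices and let $W_1,\dots,W_r$ be the vertex sets of the components of $G-B$; if $u\in B$, $w\in W_i$, and $w$ is the only white neighbor of $u$ in $G[W_i\cup B]$, then $w$ may be colored blue. $B$ is a PSD forcing set if repeated application from exactly $B$ blue colors all vertices; $\mathrm{Z}_+(G)$ is the minimum size of a PSD forcing set. $B^{[0]}=B$, $B^{[i+1]}$ is $B^{[i]}$ together with all vertices that can be PSD forced when exactly $B^{[i]}$ is blue, $\mathrm{pt}_+(G;B)$ is the least $t$ with $B^{[t]}=V(G)$, and $\mathrm{pt}_+(G)=\min\{\mathrm{pt}_+(G;B):|B|=\mathrm{Z}_+(G)\}$. *)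

theory Defs
  imports Complex_Main "Graph_Theory.Graph_Theory"
begin

text \<open>
  Finite simple graphs are modelled by the locale \<^locale>\<open>pair_graph\<close>: finite, loop-free,
  symmetric digraphs whose arcs are pairs of vertices; an undirected edge is represented by
  both of its orientations.
\<close>

definition graph_complement :: "'a pair_pre_digraph \<Rightarrow> 'a pair_pre_digraph" where
  "graph_complement G =
     \<lparr> pverts = pverts G,
       parcs = {(u, v). u \<in> pverts G \<and> v \<in> pverts G \<and> u \<noteq> v \<and> (u, v) \<notin> parcs G} \<rparr>"

text \<open>For symmetric digraphs, strongly connected components are the usual components.\<close>

definition white_components :: "'a pair_pre_digraph \<Rightarrow> 'a set \<Rightarrow> 'a set set" where
  "white_components G B = pre_digraph.sccs_verts (with_proj G \<restriction> (pverts G - B))"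

definition psd_force :: "'a pair_pre_digraph \<Rightarrow> 'a set \<Rightarrow> 'a \<Rightarrow> 'a \<Rightarrow> bool" where
  "psd_force G B u w \<longleftrightarrow>
     u \<in> B \<and>
     (\<exists>W \<in> white_components G B.
        w \<in> W \<and> {x. x \<notin> B \<and> u \<rightarrow>\<^bsub>with_proj G \<restriction> (W \<union> B)\<^esub> x} = {w})"

definition psd_color_change :: "'a pair_pre_digraph \<Rightarrow> 'a set \<Rightarrow> 'a set \<Rightarrow> bool" where
  "psd_color_change G B B' \<longleftrightarrow> (\<exists>u w. psd_force G B u w \<and> B' = insert w B)"

definition psd_forcing_set :: "'a pair_pre_digraph \<Rightarrow> 'a set \<Rightarrow> bool" where
  "psd_forcing_set G B \<longleftrightarrow> B \<subseteq> pverts G \<and> (psd_color_change G)\<^sup>*\<^sup>* B (pverts G)"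

definition psd_forcing_number :: "'a pair_pre_digraph \<Rightarrow> nat" where
  "psd_forcing_number G = (LEAST k. \<exists>B. psd_forcing_set G B \<and> card B = k)"

primrec psd_blue :: "'a pair_pre_digraph \<Rightarrow> 'a set \<Rightarrow> nat \<Rightarrow> 'a set" where
  "psd_blue G B 0 = B"
| "psd_blue G B (Suc i) = psd_blue G B i \<union> {w. \<exists>u. psd_force G (psd_blue G B i) u w}"

text \<open>Only meaningful for PSD forcing sets; for other sets no suitable time step exists.\<close>

definition psd_prop_time_of :: "'a pair_pre_digraph \<Rightarrow> 'a set \<Rightarrow> nat" where
  "psd_prop_time_of G B = (LEAST t. psd_blue G B t = pverts G)"

text \<open>
  The minimum is restricted to PSD forcing sets: sets of minimum size that are not forcing have
  no (or infinite) propagation time and must not contribute.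
\<close>

definition psd_prop_time :: "'a pair_pre_digraph \<Rightarrow> nat" where
  "psd_prop_time G =
     (LEAST t. \<exists>B. psd_forcing_set G B \<and> card B = psd_forcing_number G
                  \<and> psd_prop_time_of G B = t)"

end

theory Submission
  imports Defs
begin

text \<open>
  Write \<open>n\<close> for the order of \<open>G\<close> and \<open>Z\<close> for the PSD forcing number. The upper bound follows from
  \<open>pt(G) \<le> \<lceil>(n - Z(G)) / 2\<rceil>\<close> and \<open>Z(G) + Z(complement of G) \<ge> n - 2\<close>.

  For the first inequality, take a minimum forcing set of least propagation time \<open>T\<close> and a white
  component \<open>W\<close> that needs all \<open>T\<close> steps. If \<open>T\<close> exceeded the bound, \<open>W\<close> would contain more than half
  of the white vertices, so everything outside \<open>W\<close> would be finished early. Replacing each vertex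
  that forces into \<open>W\<close> in the first step by the vertex it forces saves one step on \<open>W\<close> and costs
  at most one step elsewhere, contradicting the choice of \<open>T\<close>.

  For the second inequality, forces show that the boundary of a white component never has more than
  \<open>Z\<close> vertices. In the complement this yields a chordal completion with cliques of size at most
  \<open>Z + 1\<close>. In \<open>G\<close> one follows the forces into the white component that contains two vertices not
  adjacent in this completion. Such pairs are adjacent in \<open>G\<close>, and two of them in different
  components would give an induced 4-cycle of the chordal graph, so the descent can only end with a
  boundary plus one vertex whose removal leaves a clique of the completion.

  Equality with \<open>n / 2 + 2\<close> is attained by a path attached to a self-complementary graph on eight
  vertices: every set of three vertices leaves the path or the core unfinished for long enough.
\<close>

section \<open>White components and propagation\<close>

text \<open>Reachability through white vertices in inductive form, so that facts about components
  follow by rule induction. The set is empty when \<open>w\<close> is blue or not a vertex.\<close>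

inductive_set white_comp :: "'a pair_pre_digraph \<Rightarrow> 'a set \<Rightarrow> 'a \<Rightarrow> 'a set"
  for G B w where
  self: "w \<in> pverts G \<Longrightarrow> w \<notin> B \<Longrightarrow> w \<in> white_comp G B w"
| step: "x \<in> white_comp G B w \<Longrightarrow> (x, y) \<in> parcs G \<Longrightarrow> y \<notin> B \<Longrightarrow> y \<in> white_comp G B w"

lemma white_comp_disjoint: "x \<in> white_comp G B w \<Longrightarrow> x \<notin> B"
  by (induction rule: white_comp.induct) auto

lemma white_comp_root: "x \<in> white_comp G B w \<Longrightarrow> w \<in> pverts G \<and> w \<notin> B"
  by (induction rule: white_comp.induct) auto

lemma white_comp_antimono: "B \<subseteq> B' \<Longrightarrow> white_comp G B' w \<subseteq> white_comp G B w"
proof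
  fix x assume "B \<subseteq> B'" and "x \<in> white_comp G B' w"
  from this(2,1) show "x \<in> white_comp G B w"
    by induction (auto intro: white_comp.intros)
qed

lemma white_comp_trans:
  assumes "y \<in> white_comp G B x" "x \<in> white_comp G B w"
  shows "y \<in> white_comp G B w"
  using assms by induction (auto intro: white_comp.step)

context pair_graph
begin

lemma arc_sym: "(u, v) \<in> parcs G \<longleftrightarrow> (v, u) \<in> parcs G"
  using arcs_symmetric by auto

lemma no_loop: "(u, u) \<notin> parcs G"
  using pair_no_loops by fastforce

lemma white_comp_verts: "x \<in> white_comp G B w \<Longrightarrow> x \<in> pverts G"
  by (induction rule: white_comp.induct) (auto simp: in_arcsD2)

lemma white_comp_sym:
  assumes "x \<in> white_comp G B w"
  shows "w \<in> white_comp G B x"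
  using assms
proof induction
  case self
  then show ?case by (rule white_comp.self)
next
  case (step x y)
  then have "x \<notin> B" by (auto dest: white_comp_disjoint)
  with step have "x \<in> white_comp G B y"
    using arc_sym in_arcsD2 by (meson white_comp.intros)
  with step show ?case by (auto intro: white_comp_trans)
qed

lemma white_comp_eq:
  assumes "x \<in> white_comp G B w"
  shows "white_comp G B x = white_comp G B w"
  using white_comp_trans[OF _ assms] white_comp_trans[OF _ white_comp_sym[OF assms]]
  by (intro equalityI subsetI)

lemma white_reachable_iff:
  "reachable (with_proj G \<restriction> (pverts G - B)) w x \<longleftrightarrow> x \<in> white_comp G B w"
proof
  let ?H = "with_proj G \<restriction> (pverts G - B)"
  assume "reachable ?H w x"
  then have "(w, x) \<in> rtrancl_on (pverts G - B) (arcs_ends ?H)"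
    by (simp add: reachable_def)
  then show "x \<in> white_comp G B w"
    by (induction rule: rtrancl_on.induct) (auto simp: arcs_ends_conv intro: white_comp.intros)
next
  let ?H = "with_proj G \<restriction> (pverts G - B)"
  assume "x \<in> white_comp G B w"
  then have "(w, x) \<in> rtrancl_on (pverts G - B) (arcs_ends ?H)"
  proof induction
    case (step x y)
    then have "(x, y) \<in> arcs_ends ?H" "y \<in> pverts G - B"
      using white_comp_verts white_comp_disjoint in_arcsD2
      by (force simp: arcs_ends_conv)+
    with step show ?case by (blast intro: rtrancl_on_into_rtrancl_on)
  qed auto
  then show "reachable ?H w x" by (simp add: reachable_def)
qed

text \<open>Arcs come in both orientations, so white reachability is symmetric and a strongly
  connected component is the reachability class of any of its vertices.\<close>

lemma white_components_iff:
  "W \<in> white_components G B \<longleftrightarrow> (\<exists>w \<in> pverts G - B. W = white_comp G B w)"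
proof
  assume W: "W \<in> white_components G B"
  then obtain w where w: "w \<in> W"
    unfolding white_components_def pre_digraph.sccs_verts_def by blast
  have "W = white_comp G B w"
  proof (intro equalityI subsetI)
    fix x assume "x \<in> W"
    with W w show "x \<in> white_comp G B w"
      unfolding white_components_def pre_digraph.sccs_verts_def by (simp add: white_reachable_iff)
  next
    fix x assume "x \<in> white_comp G B w"
    moreover from this have "w \<in> white_comp G B x" by (rule white_comp_sym)
    ultimately show "x \<in> W" using W w
      unfolding white_components_def pre_digraph.sccs_verts_def by (auto simp: white_reachable_iff)
  qed
  moreover from this w have "w \<in> pverts G - B" using white_comp_root[of w G B w] by simp
  ultimately show "\<exists>w \<in> pverts G - B. W = white_comp G B w" by blast
next
  assume "\<exists>w \<in> pverts G - B. W = white_comp G B w"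
  then obtain w where "w \<in> pverts G - B" and W: "W = white_comp G B w" by blast
  then have "w \<in> W" by (auto intro: white_comp.self)
  with W show "W \<in> white_components G B"
    unfolding white_components_def pre_digraph.sccs_verts_def
    by (auto simp: white_reachable_iff dest: white_comp_eq)
qed

text \<open>The component in the color change rule contains \<open>w\<close>, hence equals
  \<open>white_comp G B w\<close>; a force only asks that \<open>u\<close> has no second neighbor
  there.\<close>

lemma psd_force_iff:
  "psd_force G B u w \<longleftrightarrow> u \<in> B \<and> w \<in> pverts G \<and> w \<notin> B \<and> (u, w) \<in> parcs G \<and>
     (\<forall>x \<in> white_comp G B w. (u, x) \<in> parcs G \<longrightarrow> x = w)"
proof -
  have white: "{x. x \<notin> B \<and> u \<rightarrow>\<^bsub>with_proj G \<restriction> (white_comp G B w \<union> B)\<^esub> x} =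
      {x \<in> white_comp G B w. (u, x) \<in> parcs G}" if "u \<in> B"
    using that white_comp_disjoint by (force simp: arcs_ends_conv)
  show ?thesis
  proof
    assume "psd_force G B u w"
    then obtain W where u: "u \<in> B" and "W \<in> white_components G B" "w \<in> W"
      and F: "{x. x \<notin> B \<and> u \<rightarrow>\<^bsub>with_proj G \<restriction> (W \<union> B)\<^esub> x} = {w}"
      by (auto simp: psd_force_def)
    then obtain v where "w \<in> white_comp G B v" and Wv: "W = white_comp G B v"
      by (auto simp: white_components_iff)
    then have W: "W = white_comp G B w" and "w \<in> pverts G" "w \<notin> B"
      using white_comp_eq[of w B v] white_comp_verts[of w B v] white_comp_disjoint[of w G B v]
      by simp_all
    with F white[OF u] have "{x \<in> white_comp G B w. (u, x) \<in> parcs G} = {w}" by simp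
    with u \<open>w \<in> pverts G\<close> \<open>w \<notin> B\<close>
    show "u \<in> B \<and> w \<in> pverts G \<and> w \<notin> B \<and> (u, w) \<in> parcs G \<and>
      (\<forall>x \<in> white_comp G B w. (u, x) \<in> parcs G \<longrightarrow> x = w)" by blast
  next
    assume *: "u \<in> B \<and> w \<in> pverts G \<and> w \<notin> B \<and> (u, w) \<in> parcs G \<and>
      (\<forall>x \<in> white_comp G B w. (u, x) \<in> parcs G \<longrightarrow> x = w)"
    then have "w \<in> white_comp G B w" by (auto intro: white_comp.self)
    moreover from this * have "{x \<in> white_comp G B w. (u, x) \<in> parcs G} = {w}" by auto
    moreover from * have "white_comp G B w \<in> white_components G B"
      by (auto simp: white_components_iff)
    ultimately show "psd_force G B u w"
      using * white unfolding psd_force_def by (intro conjI bexI[of _ "white_comp G B w"]) simp_all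
  qed
qed

text \<open>\<open>B\<close> and \<open>B'\<close> need not be comparable: if the component of the
  target does not grow, no new competitor of \<open>w\<close> can appear.\<close>

lemma psd_force_transfer:
  assumes "psd_force G B u w" "u \<in> B'" "w \<notin> B'" "white_comp G B' w \<subseteq> white_comp G B w"
  shows "psd_force G B' u w"
  using assms unfolding psd_force_iff by blast

lemma psd_force_mono:
  assumes "psd_force G B u w" "B \<subseteq> B'" "w \<notin> B'"
  shows "psd_force G B' u w"
proof (rule psd_force_transfer[OF assms(1)])
  show "u \<in> B'" using assms by (auto simp: psd_force_iff)
qed (use assms white_comp_antimono[of B B' G w] in auto)

lemma psd_blue_subset: "B \<subseteq> pverts G \<Longrightarrow> psd_blue G B i \<subseteq> pverts G"
  by (induction i) (auto simp: psd_force_iff)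

lemma psd_blue_incseq: "i \<le> j \<Longrightarrow> psd_blue G B i \<subseteq> psd_blue G B j"
  by (induction j) (auto simp: le_Suc_eq)

text \<open>\<open>k\<close> is a delay: a start that covers \<open>B\<close> after \<open>k\<close>
  steps never falls further behind. For \<open>k = 0\<close> this is monotonicity in the initial
  set.\<close>

lemma psd_blue_mono: "B \<subseteq> psd_blue G B' k \<Longrightarrow> psd_blue G B i \<subseteq> psd_blue G B' (k + i)"
proof (induction i)
  case (Suc i)
  then have IH: "psd_blue G B i \<subseteq> psd_blue G B' (k + i)" by simp
  have "w \<in> psd_blue G B' (Suc (k + i))" if "psd_force G (psd_blue G B i) u w" for u w
    using psd_force_mono[OF that IH] by auto
  with IH show ?case by auto
qed simp

lemma color_change_blue:
  assumes "(psd_color_change G)\<^sup>*\<^sup>* B C"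
  shows "\<exists>t. C \<subseteq> psd_blue G B t"
  using assms
proof induction
  case (step C D)
  then obtain t u w where t: "C \<subseteq> psd_blue G B t" and "psd_force G C u w" "D = insert w C"
    by (auto simp: psd_color_change_def)
  then have "D \<subseteq> psd_blue G B (Suc t)"
    using psd_force_mono[OF \<open>psd_force G C u w\<close> t] by auto
  then show ?case by blast
qed (auto intro: exI[of _ 0])

text \<open>Simultaneous forces can be carried out one by one, because additional blue vertices
  never invalidate a force on a vertex that is still white.\<close>

lemma color_change_force_all:
  assumes "finite S" "\<forall>w \<in> S. w \<in> B \<or> (\<exists>u. psd_force G B u w)"
  shows "(psd_color_change G)\<^sup>*\<^sup>* B (B \<union> S)"
  using assms
proof (induction S)
  case (insert w S)
  then have IH: "(psd_color_change G)\<^sup>*\<^sup>* B (B \<union> S)" by simp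
  show ?case
  proof (cases "w \<in> B \<union> S")
    case True
    with IH show ?thesis by (simp add: insert_absorb)
  next
    case False
    with insert.prems obtain u where "psd_force G B u w" by auto
    then have "psd_force G (B \<union> S) u w" by (rule psd_force_mono) (use False in auto)
    then have "psd_color_change G (B \<union> S) (B \<union> insert w S)"
      by (auto simp: psd_color_change_def)
    with IH show ?thesis by (rule rtranclp.rtrancl_into_rtrancl)
  qed
qed simp

lemma color_change_psd_blue:
  assumes "B \<subseteq> pverts G"
  shows "(psd_color_change G)\<^sup>*\<^sup>* B (psd_blue G B t)"
proof (induction t)
  case (Suc t)
  have "finite {w. \<exists>u. psd_force G (psd_blue G B t) u w}"
    by (rule finite_subset[OF _ pair_finite_verts]) (auto simp: psd_force_iff)
  then have "(psd_color_change G)\<^sup>*\<^sup>* (psd_blue G B t) (psd_blue G B (Suc t))"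
    using color_change_force_all by force
  with Suc show ?case by (rule rtranclp_trans)
qed simp

lemma psd_forcing_set_iff:
  "psd_forcing_set G B \<longleftrightarrow> B \<subseteq> pverts G \<and> (\<exists>t. psd_blue G B t = pverts G)"
proof
  assume "psd_forcing_set G B"
  then show "B \<subseteq> pverts G \<and> (\<exists>t. psd_blue G B t = pverts G)"
    using color_change_blue psd_blue_subset by (metis psd_forcing_set_def subset_antisym)
next
  assume "B \<subseteq> pverts G \<and> (\<exists>t. psd_blue G B t = pverts G)"
  then show "psd_forcing_set G B"
    unfolding psd_forcing_set_def by (metis color_change_psd_blue)
qed

lemma psd_forcing_set_verts: "psd_forcing_set G (pverts G)"
  by (simp add: psd_forcing_set_def)

lemma psd_forcing_set_finite: "psd_forcing_set G B \<Longrightarrow> finite B"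
  unfolding psd_forcing_set_def using pair_finite_verts finite_subset by blast

lemma psd_forcing_number_le: "psd_forcing_set G B \<Longrightarrow> psd_forcing_number G \<le> card B"
  unfolding psd_forcing_number_def by (rule Least_le) blast

lemma psd_forcing_number_attained: "\<exists>B. psd_forcing_set G B \<and> card B = psd_forcing_number G"
  unfolding psd_forcing_number_def by (rule LeastI_ex) (use psd_forcing_set_verts in blast)

lemma psd_blue_prop_time_of:
  assumes "psd_forcing_set G B"
  shows "psd_blue G B (psd_prop_time_of G B) = pverts G"
  unfolding psd_prop_time_of_def by (rule LeastI_ex) (use assms psd_forcing_set_iff in blast)

lemma psd_prop_time_attained:
  "\<exists>B. psd_forcing_set G B \<and> card B = psd_forcing_number G \<and>
       psd_blue G B (psd_prop_time G) = pverts G"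
proof -
  have "\<exists>B. psd_forcing_set G B \<and> card B = psd_forcing_number G \<and>
      psd_prop_time_of G B = psd_prop_time G"
    unfolding psd_prop_time_def by (rule LeastI_ex) (use psd_forcing_number_attained in blast)
  then show ?thesis using psd_blue_prop_time_of by metis
qed

lemma psd_prop_time_le:
  assumes "B \<subseteq> pverts G" "card B = psd_forcing_number G" "psd_blue G B t = pverts G"
  shows "psd_prop_time G \<le> t"
proof -
  have "psd_forcing_set G B" using assms psd_forcing_set_iff by blast
  then have "psd_prop_time G \<le> psd_prop_time_of G B"
    unfolding psd_prop_time_def using assms(2) by (intro Least_le) blast
  also have "\<dots> \<le> t" unfolding psd_prop_time_of_def by (rule Least_le) (fact assms(3))
  finally show ?thesis .
qed

end

section \<open>The bound on the propagation time\<close>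

context pair_graph
begin

text \<open>Blue neighbors of a vertex of \<open>U\<close> lie in \<open>B\<close> or in
  \<open>U\<close>, and its white component never leaves \<open>U\<close>. So \<open>U\<close>
  evolves independently of the rest: after one step without progress inside \<open>U\<close>, any
  later force inside \<open>U\<close> would already have been available.\<close>

lemma psd_blue_stall:
  assumes closed: "\<And>x y. x \<in> U \<Longrightarrow> (x, y) \<in> parcs G \<Longrightarrow> y \<notin> B \<Longrightarrow> y \<in> U"
    and stall: "psd_blue G B (Suc i) \<inter> U \<subseteq> psd_blue G B i"
  shows "psd_blue G B (i + k) \<inter> U \<subseteq> psd_blue G B i"
proof (induction k)
  case (Suc k)
  let ?X = "psd_blue G B i" and ?Y = "psd_blue G B (i + k)"
  have XY: "?X \<subseteq> ?Y" and BX: "B \<subseteq> ?X"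
    using psd_blue_incseq[of i "i + k" B] psd_blue_incseq[of 0 i B] by auto
  have "w \<in> ?X" if "psd_force G ?Y u w" "w \<in> U" for u w
  proof (rule ccontr)
    assume w: "w \<notin> ?X"
    have u: "u \<in> ?Y" "(w, u) \<in> parcs G"
      using that(1) arc_sym by (auto simp: psd_force_iff)
    with closed[OF \<open>w \<in> U\<close>] Suc BX have "u \<in> ?X" by blast
    have "x \<in> white_comp G ?Y w \<and> x \<in> U" if "x \<in> white_comp G ?X w" for x
      using that
    proof induction
      case self
      then show ?case
        using \<open>w \<in> U\<close> \<open>psd_force G ?Y u w\<close> by (auto simp: psd_force_iff intro: white_comp.self)
    next
      case (step x y)
      then have "y \<in> U" using closed BX by blast
      moreover from this have "y \<notin> ?Y" using step Suc by blast
      ultimately show ?case using step by (blast intro: white_comp.step)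
    qed
    then have "psd_force G ?X u w"
      using psd_force_transfer[OF \<open>psd_force G ?Y u w\<close> \<open>u \<in> ?X\<close> w] by blast
    with stall \<open>w \<in> U\<close> have "w \<in> ?X" by auto
    with w show False by blast
  qed
  with Suc show ?case by auto
qed simp

text \<open>Until \<open>U\<close> is full every step adds a vertex of \<open>U\<close>; otherwise
  \<open>U\<close> would stall forever, although \<open>B\<close> eventually colors
  everything.\<close>

lemma psd_blue_fills_closed:
  assumes closed: "\<And>x y. x \<in> U \<Longrightarrow> (x, y) \<in> parcs G \<Longrightarrow> y \<notin> B \<Longrightarrow> y \<in> U"
    and "U \<subseteq> pverts G" and t: "psd_blue G B t = pverts G"
  shows "U \<subseteq> psd_blue G B (card U)"
proof -
  have fin: "finite U" using assms(2) pair_finite_verts finite_subset by blast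
  have "U \<subseteq> psd_blue G B i \<or> i \<le> card (psd_blue G B i \<inter> U)" for i
  proof (induction i)
    case (Suc i)
    show ?case
    proof (cases "psd_blue G B (Suc i) \<inter> U \<subseteq> psd_blue G B i")
      case True
      have "psd_blue G B t \<subseteq> psd_blue G B (i + t)" by (rule psd_blue_incseq) simp
      moreover have "psd_blue G B (i + t) \<inter> U \<subseteq> psd_blue G B i"
        by (rule psd_blue_stall[OF _ True]) (rule closed)
      ultimately show ?thesis using t assms(2) by auto
    next
      case False
      then have "psd_blue G B i \<inter> U \<subset> psd_blue G B (Suc i) \<inter> U" by auto
      then have "card (psd_blue G B i \<inter> U) < card (psd_blue G B (Suc i) \<inter> U)"
        using fin by (intro psubset_card_mono) auto
      with Suc show ?thesis by auto
    qed
  qed simp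
  from this[of "card U"] show ?thesis
  proof
    assume "card U \<le> card (psd_blue G B (card U) \<inter> U)"
    then have "psd_blue G B (card U) \<inter> U = U" using fin by (intro card_seteq) auto
    then show ?thesis by blast
  qed
qed

text \<open>Each vertex that forces into \<open>W\<close> in the first step is exchanged for the
  vertex it forces. Inside \<open>W\<close> this anticipates one step; the removed forcers are
  forced back in the first step, so everywhere else at most one step is lost.\<close>

lemma psd_migration:
  assumes B: "B \<subseteq> pverts G" and W: "W = white_comp G B x"
  obtains B' where "B' \<subseteq> pverts G" "card B' = card B"
    "\<And>i. psd_blue G B (Suc i) \<inter> W \<subseteq> psd_blue G B' i"
    "\<And>i. psd_blue G B i \<subseteq> psd_blue G B' (Suc i)"
proof -
  define ws where "ws = psd_blue G B 1 \<inter> W"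
  define f where "f w = (SOME u. psd_force G B u w)" for w
  define B' where "B' = (B - f ` ws) \<union> ws"
  have finB: "finite B" using B pair_finite_verts finite_subset by blast
  have WB: "W \<inter> B = {}" "W \<subseteq> pverts G"
    unfolding W using white_comp_disjoint[of _ G B x] white_comp_verts[of _ B x] by auto
  have closed: "y \<in> W" if "z \<in> W" "(z, y) \<in> parcs G" "y \<notin> B" for z y
    using that W by (blast intro: white_comp.step)
  have f: "psd_force G B (f w) w" if "w \<in> ws" for w
  proof -
    have "\<exists>u. psd_force G B u w" using that WB by (auto simp: ws_def)
    then show ?thesis unfolding f_def by (rule someI_ex)
  qed
  \<comment> \<open>The white component of \<open>w\<close> is all of \<open>W\<close>, so a chosen
    forcer sees exactly one vertex of \<open>W\<close>. This makes \<open>f\<close> injective and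
    keeps removed forcers away from the rest of \<open>W\<close>.\<close>
  have only: "y = w" if "w \<in> ws" "y \<in> W" "(f w, y) \<in> parcs G" for w y
  proof -
    have "white_comp G B w = W" using that(1) W white_comp_eq by (auto simp: ws_def)
    with that f[OF that(1)] show ?thesis by (auto simp: psd_force_iff)
  qed
  have fB: "f ` ws \<subseteq> B" using f by (auto simp: psd_force_iff)
  have inj: "inj_on f ws"
  proof (rule inj_onI)
    fix w w' assume w: "w \<in> ws" "w' \<in> ws" and eq: "f w = f w'"
    have "(f w, w') \<in> parcs G" using f[OF w(2)] unfolding eq psd_force_iff by blast
    then have "w' = w" using only[OF w(1)] w(2) by (simp add: ws_def)
    then show "w = w'" by simp
  qed
  have wsW: "ws \<subseteq> W" by (auto simp: ws_def)
  show ?thesis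
  proof (rule that)
    show "B' \<subseteq> pverts G" using B WB wsW by (auto simp: B'_def)
    have fin: "finite ws" by (rule finite_subset[OF _ pair_finite_verts]) (use wsW WB in auto)
    have "card B' = card (B - f ` ws) + card ws"
      unfolding B'_def using finB fin WB wsW by (intro card_Un_disjoint) auto
    also have "\<dots> = card B"
      using card_Diff_subset[OF finite_imageI[OF fin] fB] card_mono[OF finB fB] card_image[OF inj]
      by simp
    finally show "card B' = card B" .
    show "psd_blue G B (Suc i) \<inter> W \<subseteq> psd_blue G B' i" for i
    proof (induction i)
      case 0
      then show ?case by (auto simp: B'_def ws_def)
    next
      case (Suc i)
      let ?X = "psd_blue G B (Suc i)" and ?Y = "psd_blue G B' i"
      have B'Y: "B' \<subseteq> ?Y" using psd_blue_incseq[of 0 i B'] by simp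
      have "w \<in> psd_blue G B' (Suc i)" if F: "psd_force G ?X u w" and "w \<in> W" for u w
      proof (cases "w \<in> ?Y")
        case False
        have u: "u \<in> ?X" "(w, u) \<in> parcs G" "(u, w) \<in> parcs G"
          using F arc_sym by (auto simp: psd_force_iff)
        have "w \<notin> ws" using False B'Y by (auto simp: B'_def)
        \<comment> \<open>A removed forcer meets \<open>W\<close> only in \<open>ws\<close>, so it
          cannot be the source of a force on \<open>w\<close>.\<close>
        have "u \<in> ?Y"
        proof (cases "u \<in> B")
          case True
          then have "u \<notin> f ` ws" using only u \<open>w \<in> W\<close> \<open>w \<notin> ws\<close> by blast
          with True B'Y show ?thesis by (auto simp: B'_def)
        next
          case False
          with closed \<open>w \<in> W\<close> u Suc show ?thesis by blast
        qed
        \<comment> \<open>Leaving \<open>W\<close> would require a removed forcer next to a white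
          vertex of \<open>W\<close>, but its only neighbor in \<open>W\<close> belongs to
          \<open>ws\<close> and is blue.\<close>
        have "z \<in> white_comp G ?X w \<and> z \<in> W" if "z \<in> white_comp G ?Y w" for z
          using that
        proof induction
          case self
          have "w \<in> pverts G" "w \<notin> ?X" using F unfolding psd_force_iff by blast+
          with \<open>w \<in> W\<close> show ?case by (blast intro: white_comp.self)
        next
          case (step z y)
          have "z \<notin> ws" using white_comp_disjoint[OF step(1)] B'Y by (auto simp: B'_def)
          have "y \<in> W"
          proof (rule closed[of z])
            show "y \<notin> B"
            proof
              assume "y \<in> B"
              with step B'Y have "y \<in> f ` ws" by (auto simp: B'_def)
              with only step arc_sym \<open>z \<notin> ws\<close> show False by blast
            qed
          qed (use step in auto)
          moreover from this have "y \<notin> ?X" using step Suc by blast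
          ultimately show ?case using step by (blast intro: white_comp.step)
        qed
        then have "psd_force G ?Y u w"
          using psd_force_transfer[OF F \<open>u \<in> ?Y\<close> False] by blast
        then show ?thesis by auto
      qed auto
      moreover have "?Y \<subseteq> psd_blue G B' (Suc i)" by auto
      ultimately show ?case using Suc unfolding psd_blue.simps(2)[of G B "Suc i"] by blast
    qed
    \<comment> \<open>The force is reversed: the component of \<open>f w\<close> avoids
      \<open>W\<close>, so a neighbor of \<open>w\<close> in it is a removed forcer, and the only
      one that \<open>w\<close> sees is \<open>f w\<close>.\<close>
    have "f w \<in> psd_blue G B' 1" if "w \<in> ws" for w
    proof -
      have "f w \<in> B" "(f w, w) \<in> parcs G" "f w \<notin> W" "f w \<notin> B'"
        using f[OF that] fB that WB wsW by (auto simp: psd_force_iff B'_def)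
      have "z \<notin> W \<and> (z \<in> f ` ws \<or> z \<notin> B)" if "z \<in> white_comp G B' (f w)" for z
        using that
      proof induction
        case self
        then show ?case using \<open>w \<in> ws\<close> \<open>f w \<notin> W\<close> by auto
      next
        case (step z y)
        have "y \<notin> W"
        proof
          assume "y \<in> W"
          moreover have "y \<notin> ws" using step by (auto simp: B'_def)
          ultimately show False using step only closed arc_sym by blast
        qed
        with step show ?case by (auto simp: B'_def)
      qed
      then have "z = f w" if "z \<in> white_comp G B' (f w)" "(w, z) \<in> parcs G" for z
        using that \<open>w \<in> ws\<close> wsW closed only arc_sym by (metis image_iff subsetD)
      with \<open>f w \<notin> B'\<close> \<open>f w \<in> B\<close> \<open>(f w, w) \<in> parcs G\<close> that have "psd_force G B' w (f w)"
        using B arc_sym by (auto simp: psd_force_iff B'_def)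
      then show ?thesis by auto
    qed
    then have "B \<subseteq> psd_blue G B' 1"
      using psd_blue_incseq[of 0 1 B'] by (auto simp: B'_def)
    from psd_blue_mono[OF this] show "psd_blue G B i \<subseteq> psd_blue G B' (Suc i)" for i by simp
  qed
qed

text \<open>A division-free form of the bound by the ceiling of half the number of initially white
  vertices.\<close>

theorem psd_prop_time_bound: "2 * psd_prop_time G + psd_forcing_number G \<le> card (pverts G) + 1"
proof (rule ccontr)
  let ?T = "psd_prop_time G" and ?V = "pverts G"
  assume "\<not> 2 * ?T + psd_forcing_number G \<le> card ?V + 1"
  moreover obtain B where B: "psd_forcing_set G B" "card B = psd_forcing_number G"
      "psd_blue G B ?T = ?V"
    using psd_prop_time_attained by blast
  ultimately have big: "card ?V + 2 \<le> 2 * ?T + card B" by simp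
  have BV: "B \<subseteq> ?V" using B(1) by (simp add: psd_forcing_set_def)
  then have "card B \<le> card ?V" using pair_finite_verts card_mono by blast
  with big have T: "?T > 0" by simp
  have "psd_blue G B (?T - 1) \<noteq> ?V"
    using psd_prop_time_le[OF BV B(2), of "?T - 1"] T by auto
  then obtain x where x: "x \<in> ?V" "x \<notin> psd_blue G B (?T - 1)"
    using psd_blue_subset[OF BV] by blast
  define W where "W = white_comp G B x"
  define Q where "Q = ?V - B - W"
  have WV: "W \<subseteq> ?V" "W \<inter> B = {}"
    unfolding W_def using white_comp_disjoint[of _ G B x] white_comp_verts[of _ B x] by auto
  have closed: "y \<in> W" if "z \<in> W" "(z, y) \<in> parcs G" "y \<notin> B" for z y
    using that unfolding W_def by (blast intro: white_comp.step)
  have "x \<in> W"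
    using x psd_blue_incseq[of 0 "?T - 1" B] unfolding W_def by (auto intro: white_comp.self)
  moreover have "W \<subseteq> psd_blue G B (card W)"
    by (rule psd_blue_fills_closed[OF _ WV(1) B(3)]) (rule closed)
  \<comment> \<open>The vertex \<open>x\<close> of \<open>W\<close> is still white at time
    \<open>?T - 1\<close>, so \<open>W\<close> has at least \<open>?T\<close> vertices.\<close>
  ultimately have "\<not> card W \<le> ?T - 1" using x psd_blue_incseq by blast
  then have "?T \<le> card W" by simp
  have closedQ: "y \<in> Q" if "z \<in> Q" "(z, y) \<in> parcs G" "y \<notin> B" for z y
    using that in_arcsD2 closed arc_sym unfolding Q_def by blast
  have "Q \<subseteq> psd_blue G B (card Q)"
  proof (rule psd_blue_fills_closed[OF _ _ B(3)])
    show "Q \<subseteq> ?V" by (auto simp: Q_def)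
  qed (rule closedQ)
  have "card ?V = card B + card W + card Q"
  proof -
    have V: "?V = (B \<union> W) \<union> Q" using BV WV by (auto simp: Q_def)
    have fin: "finite B" "finite W" "finite Q"
      using finite_subset[OF _ pair_finite_verts] BV WV by (auto simp: Q_def)
    have "card ?V = card (B \<union> W) + card Q"
      by (subst V, rule card_Un_disjoint) (use fin in \<open>auto simp: Q_def\<close>)
    also have "card (B \<union> W) = card B + card W"
      by (rule card_Un_disjoint) (use fin WV in auto)
    finally show ?thesis .
  qed
  \<comment> \<open>From |W| + |Q| + 2 <= 2T and T <= |W| the rest \<open>Q\<close> is full at time
    T - 2, which leaves room for the one step lost by the migration.\<close>
  with big \<open>?T \<le> card W\<close> have Q: "Suc (card Q) \<le> ?T - 1" by simp
  obtain B' where B': "B' \<subseteq> ?V" "card B' = card B"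
    and fast: "\<And>i. psd_blue G B (Suc i) \<inter> W \<subseteq> psd_blue G B' i"
    and slow: "\<And>i. psd_blue G B i \<subseteq> psd_blue G B' (Suc i)"
    using psd_migration[OF BV W_def] by metis
  have "W \<subseteq> psd_blue G B' (?T - 1)"
    using fast[of "?T - 1"] T B(3) WV by auto
  moreover have "B \<union> Q \<subseteq> psd_blue G B' (?T - 1)"
  proof -
    have "B \<union> Q \<subseteq> psd_blue G B (card Q)"
      using \<open>Q \<subseteq> psd_blue G B (card Q)\<close> psd_blue_incseq[of 0 "card Q" B] by simp
    also have "\<dots> \<subseteq> psd_blue G B' (Suc (card Q))" by (rule slow)
    also have "\<dots> \<subseteq> psd_blue G B' (?T - 1)" using Q by (rule psd_blue_incseq)
    finally show ?thesis .
  qed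
  ultimately have "psd_blue G B' (?T - 1) = ?V"
    using psd_blue_subset[OF B'(1)] unfolding Q_def by blast
  with psd_prop_time_le[OF B'(1), of "?T - 1"] B' B T show False by simp
qed

end

section \<open>Forcing numbers of a graph and its complement\<close>

definition boundary :: "'a pair_pre_digraph \<Rightarrow> 'a set \<Rightarrow> 'a set \<Rightarrow> 'a set" where
  "boundary G C D = {y \<in> C. \<exists>x \<in> D. (x, y) \<in> parcs G}"

lemma boundary_subset: "boundary G C D \<subseteq> C"
  by (auto simp: boundary_def)

context pair_graph
begin

lemma color_change_verts:
  assumes "(psd_color_change G)\<^sup>*\<^sup>* B C" "B \<subseteq> pverts G"
  shows "C \<subseteq> pverts G"
  using assms by induction (auto simp: psd_color_change_def psd_force_iff)

lemma white_comp_insert_other: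
  assumes "w \<notin> white_comp G C x"
  shows "white_comp G (insert w C) x = white_comp G C x"
proof
  show "white_comp G (insert w C) x \<subseteq> white_comp G C x"
    by (rule white_comp_antimono) auto
  show "white_comp G C x \<subseteq> white_comp G (insert w C) x"
  proof
    fix y assume "y \<in> white_comp G C x"
    then show "y \<in> white_comp G (insert w C) x"
    proof induction
      case self
      then have "x \<in> white_comp G C x" by (rule white_comp.self)
      with assms self show ?case by (metis white_comp.self insertE)
    next
      case (step y z)
      then have "z \<in> white_comp G C x" by (blast intro: white_comp.step)
      with assms step show ?case by (metis white_comp.step insertE)
    qed
  qed
qed

text \<open>If the component of \<open>x\<close> did not contain \<open>w\<close>, it is unaffected.
  Otherwise it is a piece of the old component of \<open>w\<close>; there \<open>w\<close> was the
  only neighbor of \<open>u\<close>, so \<open>u\<close> leaves the boundary and at most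
  \<open>w\<close> enters.\<close>

lemma boundary_force:
  assumes F: "psd_force G C u w" and x: "x \<in> pverts G" "x \<notin> insert w C"
  shows "boundary G (insert w C) (white_comp G (insert w C) x) \<subseteq> boundary G C (white_comp G C x) \<or>
    boundary G (insert w C) (white_comp G (insert w C) x)
      \<subseteq> insert w (boundary G C (white_comp G C w) - {u})"
proof (cases "w \<in> white_comp G C x")
  case True
  let ?W = "white_comp G C w" and ?D = "white_comp G (insert w C) x"
  have W: "white_comp G C x = ?W" using white_comp_eq[OF True] by simp
  have D: "?D \<subseteq> ?W" "w \<notin> ?D"
    using white_comp_antimono[of C "insert w C" G x] W white_comp_disjoint[of w G "insert w C" x]
    by auto
  have "(y, u) \<notin> parcs G" if "y \<in> ?D" for y
  proof
    assume "(y, u) \<in> parcs G"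
    with that D F have "y = w" using arc_sym unfolding psd_force_iff by blast
    with that D show False by simp
  qed
  with D have "boundary G (insert w C) ?D \<subseteq> insert w (boundary G C ?W - {u})"
    by (auto simp: boundary_def)
  then show ?thesis ..
next
  case False
  have "(y, w) \<notin> parcs G" if "y \<in> white_comp G C x" for y
    using that False F white_comp.step[of y G C x w] by (auto simp: psd_force_iff)
  then show ?thesis using white_comp_insert_other[OF False] by (auto simp: boundary_def)
qed

lemma card_boundary_force:
  assumes F: "psd_force G C u w" and fin: "finite C"
    and bound: "\<And>x. x \<in> pverts G \<Longrightarrow> x \<notin> C \<Longrightarrow> card (boundary G C (white_comp G C x)) \<le> k"
    and x: "x \<in> pverts G" "x \<notin> insert w C"
  shows "card (boundary G (insert w C) (white_comp G (insert w C) x)) \<le> k"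
proof -
  let ?W = "boundary G C (white_comp G C w)"
  have finb: "finite (boundary G C D)" for D
    by (rule finite_subset[OF boundary_subset fin])
  have w: "w \<in> pverts G" "w \<notin> C" "(u, w) \<in> parcs G" "u \<in> C"
    using F unfolding psd_force_iff by auto
  then have "w \<in> white_comp G C w" by (auto intro: white_comp.self)
  then have "u \<in> ?W" using w arc_sym by (auto simp: boundary_def)
  moreover have "w \<notin> ?W" using w by (auto simp: boundary_def)
  ultimately have swap: "card (insert w (?W - {u})) = card ?W"
    using finb card_Suc_Diff1 by (metis Diff_iff card_insert_disjoint finite_Diff)
  from boundary_force[OF F x] show ?thesis
  proof
    assume "boundary G (insert w C) (white_comp G (insert w C) x) \<subseteq> boundary G C (white_comp G C x)"
    from card_mono[OF finb this] bound x show ?thesis by (meson insertCI le_trans)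
  next
    assume "boundary G (insert w C) (white_comp G (insert w C) x) \<subseteq> insert w (?W - {u})"
    then have "card (boundary G (insert w C) (white_comp G (insert w C) x)) \<le> card ?W"
      using card_mono[of "insert w (?W - {u})"] finb swap by simp
    with bound[OF w(1,2)] show ?thesis by simp
  qed
qed

text \<open>Initially every boundary lies in \<open>B\<close>, and each force at most exchanges one
  boundary vertex for another.\<close>

lemma card_boundary_le:
  assumes "(psd_color_change G)\<^sup>*\<^sup>* B C" "B \<subseteq> pverts G" "x \<in> pverts G" "x \<notin> C"
  shows "card (boundary G C (white_comp G C x)) \<le> card B"
  using assms
proof (induction arbitrary: x)
  case base
  have "finite B" by (rule finite_subset[OF base(1) pair_finite_verts])
  then show ?case by (rule card_mono) (rule boundary_subset)
next
  case (step C C')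
  then obtain u w where F: "psd_force G C u w" and C': "C' = insert w C"
    by (auto simp: psd_color_change_def)
  have "finite C"
    using finite_subset[OF color_change_verts[OF step(1) step.prems(1)] pair_finite_verts] .
  with F show ?case unfolding C'
    by (rule card_boundary_force) (use step C' in auto)
qed

text \<open>
  Eliminating the vertices in the reverse order of the forces turns the boundary of every white
  component into a clique.
\<close>

lemma psd_chordal_completion:
  assumes "psd_forcing_set G B"
  shows "\<exists>co. (\<forall>x y. (x, y) \<in> parcs G \<longrightarrow> co x y) \<and> (\<forall>x y. co x y \<longrightarrow> co y x) \<and>
      (\<forall>X \<subseteq> pverts G. (\<forall>x \<in> X. \<forall>y \<in> X. x \<noteq> y \<longrightarrow> co x y) \<longrightarrow> card X \<le> card B + 1) \<and>
      (\<forall>a b c d. co a b \<and> co b c \<and> co c d \<and> co d a \<and> a \<noteq> c \<and> b \<noteq> d \<longrightarrow> co a c \<or> co b d)"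
proof -
  have BV: "B \<subseteq> pverts G" and chain: "(psd_color_change G)\<^sup>*\<^sup>* B (pverts G)"
    using assms by (auto simp: psd_forcing_set_def)
  have finB: "finite B" using psd_forcing_set_finite[OF assms] .
  define clique where "clique co X \<longleftrightarrow> (\<forall>x \<in> X. \<forall>y \<in> X. x \<noteq> y \<longrightarrow> co x y)"
    for co :: "'a \<Rightarrow> 'a \<Rightarrow> bool" and X
  \<comment> \<open>Invariant for the blue set \<open>C\<close>: \<open>co\<close> is a symmetric
    relation on \<open>C\<close> that contains the arcs inside \<open>C\<close>, has small cliques
    and no induced 4-cycle, and turns every component boundary into a clique. The last clause drives
    the induction.\<close>
  define good where "good C co \<longleftrightarrow>
      (\<forall>x y. co x y \<longrightarrow> co y x \<and> x \<in> C \<and> y \<in> C) \<and>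
      (\<forall>x \<in> C. \<forall>y \<in> C. (x, y) \<in> parcs G \<longrightarrow> co x y) \<and>
      (\<forall>X \<subseteq> C. clique co X \<longrightarrow> card X \<le> card B + 1) \<and>
      (\<forall>a b c d. co a b \<and> co b c \<and> co c d \<and> co d a \<and> a \<noteq> c \<and> b \<noteq> d \<longrightarrow> co a c \<or> co b d) \<and>
      (\<forall>x \<in> pverts G - C. clique co (boundary G C (white_comp G C x)))"
    for C :: "'a set" and co
  from chain have "\<exists>co. good (pverts G) co"
  proof induction
    case base
    \<comment> \<open>The start is the complete graph on \<open>B\<close>.\<close>
    have "good B (\<lambda>x y. x \<in> B \<and> y \<in> B \<and> x \<noteq> y)"
      unfolding good_def clique_def using no_loop card_mono[OF finB] boundary_subset[of G B]
      by (auto intro: le_SucI)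
    then show ?case by blast
  next
    case (step C C')
    from step(2) obtain u w where F: "psd_force G C u w" and C': "C' = insert w C"
      by (auto simp: psd_color_change_def)
    from step(3) obtain co where co: "good C co" by blast
    let ?N = "boundary G C (white_comp G C w)"
    \<comment> \<open>The new vertex is joined exactly to the boundary of its component. That
      boundary is a clique with at most \<open>card B\<close> vertices, so cliques through
      \<open>w\<close> have at most one vertex more.\<close>
    define co' where "co' x y \<longleftrightarrow> co x y \<or> x = w \<and> y \<in> ?N \<or> y = w \<and> x \<in> ?N" for x y
    have w: "w \<in> pverts G" "w \<notin> C" using F by (auto simp: psd_force_iff)
    have NC: "?N \<subseteq> C" by (rule boundary_subset)
    have sym: "co y x" "x \<in> C" "y \<in> C" if "co x y" for x y
      using co that unfolding good_def by blast+
    have arcs: "co x y" if "x \<in> C" "y \<in> C" "(x, y) \<in> parcs G" for x y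
      using co that unfolding good_def by blast
    have small: "card X \<le> card B + 1" if "X \<subseteq> C" "clique co X" for X
      using co that unfolding good_def by blast
    have chord: "co a c \<or> co b d" if "co a b" "co b c" "co c d" "co d a" "a \<noteq> c" "b \<noteq> d" for a b c d
      using co that unfolding good_def by blast
    have bclique: "clique co (boundary G C (white_comp G C x))" if "x \<in> pverts G" "x \<notin> C" for x
      using co that unfolding good_def by blast
    have N: "co x y" if "x \<in> ?N" "y \<in> ?N" "x \<noteq> y" for x y
      using bclique[OF w] that by (auto simp: clique_def)
    have cardN: "card ?N \<le> card B"
      using card_boundary_le[OF step(1) BV w] .
    have finC: "finite C"
      using finite_subset[OF color_change_verts[OF step(1) BV] pair_finite_verts] .
    have co'w: "co' w y \<longleftrightarrow> y \<in> ?N" "co' y w \<longleftrightarrow> y \<in> ?N" for y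
      using w NC sym by (auto simp: co'_def)
    have co'C: "co' x y \<longleftrightarrow> co x y" if "x \<noteq> w" "y \<noteq> w" for x y
      using that by (auto simp: co'_def)
    have "good C' co'"
      unfolding good_def
    proof (intro conjI allI ballI impI)
      fix x y assume "co' x y"
      then show "co' y x" "x \<in> C'" "y \<in> C'"
        using sym NC by (auto simp: co'_def C')
    next
      fix x y assume "x \<in> C'" "y \<in> C'" "(x, y) \<in> parcs G"
      moreover have "y \<in> ?N" if "(w, y) \<in> parcs G" "y \<in> C" for y
        using that white_comp.self[OF w] by (auto simp: boundary_def)
      ultimately show "co' x y"
        using arcs no_loop arc_sym unfolding co'_def C' by blast
    next
      fix X assume X: "X \<subseteq> C'" "clique co' X"
      show "card X \<le> card B + 1"
      proof (cases "w \<in> X")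
        case True
        then have "co' w x" if "x \<in> X - {w}" for x
          using that X(2) by (auto simp: clique_def)
        then have "X - {w} \<subseteq> ?N" unfolding co'w by (rule subsetI)
        moreover have "finite ?N" by (rule finite_subset[OF NC finC])
        ultimately have "card (X - {w}) \<le> card ?N" by (simp add: card_mono)
        moreover have "finite X" using finite_subset[OF X(1)] finC by (simp add: C')
        then have "card X = card (X - {w}) + 1" using card_Suc_Diff1[OF _ True] by simp
        ultimately show ?thesis using cardN by simp
      next
        case False
        have "co x y" if "x \<in> X" "y \<in> X" "x \<noteq> y" for x y
        proof -
          have "x \<noteq> w" "y \<noteq> w" using that False by auto
          then show ?thesis using X(2) that co'C[of x y] by (auto simp: clique_def)
        qed
        with X False have "X \<subseteq> C" "clique co X" by (auto simp: clique_def C')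
        then show ?thesis by (rule small)
      qed
    next
      fix a b c d
      assume H: "co' a b \<and> co' b c \<and> co' c d \<and> co' d a \<and> a \<noteq> c \<and> b \<noteq> d"
      have coN: "co' x y" if "x \<in> ?N" "y \<in> ?N" "x \<noteq> y" for x y
        using N that by (auto simp: co'_def)
      \<comment> \<open>In a 4-cycle through \<open>w\<close> the two neighbors of \<open>w\<close>
        lie in the clique \<open>?N\<close> and form a chord.\<close>
      consider "a = w" | "b = w" | "c = w" | "d = w" | "w \<notin> {a, b, c, d}" by auto
      then show "co' a c \<or> co' b d"
      proof cases
        case 5
        then have "co a b" "co b c" "co c d" "co d a" "a \<noteq> c" "b \<noteq> d" using H co'C by auto
        then have "co a c \<or> co b d" by (rule chord)
        then show ?thesis by (auto simp: co'_def)
      qed (use H co'w coN in metis)+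
    next
      fix x assume "x \<in> pverts G - C'"
      then have x: "x \<in> pverts G" "x \<notin> insert w C" "x \<notin> C" by (auto simp: C')
      have cl: "clique co' X" if "X \<subseteq> insert w ?N \<or> X \<subseteq> boundary G C (white_comp G C x)" for X
        unfolding clique_def
      proof (intro ballI impI)
        fix y z assume "y \<in> X" "z \<in> X" "y \<noteq> z"
        with that N bclique[OF x(1,3)] show "co' y z" unfolding clique_def co'_def by blast
      qed
      from boundary_force[OF F x(1,2)] show "clique co' (boundary G C' (white_comp G C' x))"
        unfolding C' by (intro cl) blast
    qed
    then show ?case by blast
  qed
  then obtain co where co: "good (pverts G) co" ..
  show ?thesis
  proof (intro exI[of _ co] conjI)
    have "\<forall>x \<in> pverts G. \<forall>y \<in> pverts G. (x, y) \<in> parcs G \<longrightarrow> co x y"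
      using co unfolding good_def by (elim conjE)
    then show "\<forall>x y. (x, y) \<in> parcs G \<longrightarrow> co x y"
      by (meson in_arcsD1 in_arcsD2)
    have "\<forall>x y. co x y \<longrightarrow> co y x \<and> x \<in> pverts G \<and> y \<in> pverts G"
      using co unfolding good_def by (elim conjE)
    then show "\<forall>x y. co x y \<longrightarrow> co y x" by simp
    show "\<forall>X \<subseteq> pverts G. (\<forall>x \<in> X. \<forall>y \<in> X. x \<noteq> y \<longrightarrow> co x y) \<longrightarrow> card X \<le> card B + 1"
      using co unfolding good_def clique_def by (elim conjE)
    show "\<forall>a b c d. co a b \<and> co b c \<and> co c d \<and> co d a \<and> a \<noteq> c \<and> b \<noteq> d \<longrightarrow> co a c \<or> co b d"
      using co unfolding good_def by (elim conjE)
  qed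
qed

end

section \<open>Complements and the sum of the two forcing numbers\<close>

lemma pverts_complement [simp]: "pverts (graph_complement G) = pverts G"
  by (simp add: graph_complement_def)

lemma arcs_complement_iff:
  "(x, y) \<in> parcs (graph_complement G) \<longleftrightarrow> x \<in> pverts G \<and> y \<in> pverts G \<and> x \<noteq> y \<and> (x, y) \<notin> parcs G"
  by (auto simp: graph_complement_def)

lemma pair_graphI:
  assumes "finite (pverts G)"
    and "\<And>x y. (x, y) \<in> parcs G \<Longrightarrow> x \<in> pverts G \<and> y \<in> pverts G \<and> x \<noteq> y \<and> (y, x) \<in> parcs G"
  shows "pair_graph G"
proof
  show "finite (parcs G)"
    by (rule finite_subset[of _ "pverts G \<times> pverts G"]) (use assms in auto)
  show "symmetric (with_proj G)"
    unfolding symmetric_def with_proj_simps by (rule symI) (use assms in blast)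
qed (use assms in auto)

context pair_graph
begin

lemma pair_graph_complement: "pair_graph (graph_complement G)"
  by (rule pair_graphI) (use pair_finite_verts arc_sym in \<open>auto simp: arcs_complement_iff\<close>)

theorem psd_forcing_number_complement:
  "card (pverts G) \<le> psd_forcing_number G + psd_forcing_number (graph_complement G) + 2"
proof (rule ccontr)
  let ?V = "pverts G"
  interpret H: pair_graph "graph_complement G" by (rule pair_graph_complement)
  assume large: "\<not> ?thesis"
  obtain B where B: "psd_forcing_set G B" and cB: "card B = psd_forcing_number G"
    using psd_forcing_number_attained by blast
  obtain B' where B': "psd_forcing_set (graph_complement G) B'"
    and cB': "card B' = psd_forcing_number (graph_complement G)"
    using H.psd_forcing_number_attained by blast
  obtain co where arcs: "\<forall>x y. (x, y) \<in> parcs (graph_complement G) \<longrightarrow> co x y"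
    and sym: "\<forall>x y. co x y \<longrightarrow> co y x"
    and small: "\<forall>X \<subseteq> ?V. (\<forall>x \<in> X. \<forall>y \<in> X. x \<noteq> y \<longrightarrow> co x y) \<longrightarrow> card X \<le> card B' + 1"
    and chord: "\<forall>a b c d. co a b \<and> co b c \<and> co c d \<and> co d a \<and> a \<noteq> c \<and> b \<noteq> d \<longrightarrow> co a c \<or> co b d"
    using H.psd_chordal_completion[OF B'] unfolding pverts_complement by (elim exE conjE)
  have BV: "B \<subseteq> ?V" and chain: "(psd_color_change G)\<^sup>*\<^sup>* B ?V"
    using B by (auto simp: psd_forcing_set_def)
  \<comment> \<open>More than \<open>card B' + 1\<close> vertices remain outside \<open>K\<close>,
    too many for a clique of \<open>co\<close>. A pair missing from \<open>co\<close> is missing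
    from the complement, hence an arc of \<open>G\<close>.\<close>
  have pair: "\<exists>a b. a \<in> ?V - K \<and> b \<in> ?V - K \<and> a \<noteq> b \<and> \<not> co a b \<and> (a, b) \<in> parcs G"
    if K: "finite K" "card K \<le> card B + 1" for K
  proof -
    have "card B' + 1 < card ?V - card K" using large cB cB' K by simp
    also have "\<dots> \<le> card (?V - K)" by (rule diff_card_le_card_Diff[OF K(1)])
    finally have "\<not> card (?V - K) \<le> card B' + 1" by simp
    then have "\<not> (\<forall>x \<in> ?V - K. \<forall>y \<in> ?V - K. x \<noteq> y \<longrightarrow> co x y)"
      using small Diff_subset by blast
    then obtain a b where ab: "a \<in> ?V - K" "b \<in> ?V - K" "a \<noteq> b" "\<not> co a b" by blast
    with arcs have "(a, b) \<in> parcs G" unfolding arcs_complement_iff by blast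
    with ab show ?thesis by blast
  qed
  \<comment> \<open>Throughout the forcing process some white component contains a pair that is not
    adjacent in \<open>co\<close>; once everything is blue this is absurd.\<close>
  have "\<exists>a b. a \<notin> C \<and> a \<in> ?V \<and> b \<in> white_comp G C a \<and> a \<noteq> b \<and> \<not> co a b"
    if "(psd_color_change G)\<^sup>*\<^sup>* B C" for C
    using that
  proof induction
    case base
    obtain a b where "a \<in> ?V - B" "b \<in> ?V - B" "a \<noteq> b" "\<not> co a b" "(a, b) \<in> parcs G"
      using pair[of B] psd_forcing_set_finite[OF B] by auto
    then show ?case using white_comp.self[of a G B] white_comp.step[of a G B a b] by blast
  next
    case (step C C')
    then obtain u w where F: "psd_force G C u w" and C': "C' = insert w C"
      by (auto simp: psd_color_change_def)
    from step obtain a b where ab: "a \<notin> C" "a \<in> ?V" "b \<in> white_comp G C a" "a \<noteq> b" "\<not> co a b"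
      by blast
    show ?case
    proof (cases "w \<in> white_comp G C a")
      case False
      moreover from this have "a \<noteq> w" using white_comp.self[OF ab(2,1)] by auto
      ultimately show ?thesis unfolding C' using ab white_comp_insert_other by blast
    next
      case True
      define W where "W = white_comp G C w"
      \<comment> \<open>\<open>K\<close> separates \<open>W\<close> without \<open>w\<close> from
        the rest of \<open>G\<close>, and its size allows \<open>pair\<close> to be applied.\<close>
      define K where "K = insert w (boundary G C W)"
      have w: "w \<in> ?V" "w \<notin> C" using F by (auto simp: psd_force_iff)
      have WC: "W \<inter> C = {}" "W \<subseteq> ?V"
        unfolding W_def using white_comp_disjoint[of _ G C w] white_comp_verts[of _ C w] by auto
      have closed: "y \<in> W \<or> y \<in> K" if "z \<in> W" "(z, y) \<in> parcs G" for z y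
        using that white_comp.step[of z G C w y] unfolding W_def K_def boundary_def by blast
      have aW: "a \<in> W" "b \<in> W"
        using ab white_comp.self[OF ab(2,1)] white_comp_eq[OF True] by (auto simp: W_def)
      have finC: "finite C"
        using finite_subset[OF color_change_verts[OF step(1) BV] pair_finite_verts] .
      have finK: "finite (boundary G C W)" using boundary_subset finC by (rule finite_subset)
      have "card K \<le> card (boundary G C W) + 1"
        unfolding K_def using finK by (simp add: card_insert_if)
      then have "card K \<le> card B + 1"
        using card_boundary_le[OF step(1) BV w] by (simp add: W_def)
      with finK obtain a' b' where ab': "a' \<in> ?V - K" "b' \<in> ?V - K" "a' \<noteq> b'" "\<not> co a' b'"
          "(a', b') \<in> parcs G"
        using pair[of K] by (auto simp: K_def)
      have "(b', a') \<in> parcs G" using ab'(5) arc_sym by blast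
      show ?thesis
      proof (cases "a' \<in> W")
        case True
        then have "b' \<in> W" using closed ab' by blast
        then have "a' \<notin> C'" "b' \<notin> C'" using True ab' WC by (auto simp: C' K_def)
        then show ?thesis
          using ab' white_comp.self[of a' G C'] white_comp.step[of a' G C' a' b'] by blast
      next
        case False
        then have "b' \<notin> W" using closed ab' \<open>(b', a') \<in> parcs G\<close> by blast
        have cross: "co x y \<and> x \<noteq> y" if "x \<in> W" "y \<notin> W" "y \<in> ?V - K" for x y
          using that closed[of x y] arcs WC by (auto simp: arcs_complement_iff)
        \<comment> \<open>\<open>a\<close>, \<open>a'\<close>, \<open>b\<close>, \<open>b'\<close>
          is a 4-cycle of \<open>co\<close>: its sides join \<open>W\<close> to vertices outside
          \<open>W\<close> and \<open>K\<close>, which are not adjacent in \<open>G\<close>. Neither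
          diagonal is in \<open>co\<close>.\<close>
        have "co a b \<or> co a' b'"
          using chord[rule_format, of a a' b b'] cross[of a a'] cross[of b a'] cross[of b b'] cross[of a b']
            sym aW ab ab' False \<open>b' \<notin> W\<close> by blast
        with ab ab' show ?thesis by blast
      qed
    qed
  qed
  from this[OF chain] show False by blast
qed

end

section \<open>A self-complementary core\<close>

text \<open>A datatype with adjacency lists makes the finite checks executable;
  \<open>core_num\<close> embeds it into the numbers below 8.\<close>

datatype core = C0 | C1 | C2 | C3 | C4 | C5 | C6 | C7

primrec core_num :: "core \<Rightarrow> nat" where
  "core_num C0 = 0" | "core_num C1 = 1" | "core_num C2 = 2" | "core_num C3 = 3"
| "core_num C4 = 4" | "core_num C5 = 5" | "core_num C6 = 6" | "core_num C7 = 7"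

primrec core_nbs :: "core \<Rightarrow> core list" where
  "core_nbs C0 = [C1, C3, C6]"
| "core_nbs C1 = [C0, C2, C3, C5]"
| "core_nbs C2 = [C1, C5]"
| "core_nbs C3 = [C0, C1, C4, C5, C7]"
| "core_nbs C4 = [C3, C5, C6, C7]"
| "core_nbs C5 = [C1, C2, C3, C4, C6]"
| "core_nbs C6 = [C0, C4, C5]"
| "core_nbs C7 = [C3, C4]"

primrec core_conbs :: "core \<Rightarrow> core list" where
  "core_conbs C0 = [C2, C4, C5, C7]"
| "core_conbs C1 = [C4, C6, C7]"
| "core_conbs C2 = [C0, C3, C4, C6, C7]"
| "core_conbs C3 = [C2, C6]"
| "core_conbs C4 = [C0, C1, C2]"
| "core_conbs C5 = [C0, C7]"
| "core_conbs C6 = [C1, C2, C3, C7]"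
| "core_conbs C7 = [C0, C1, C2, C5, C6]"

definition core_list :: "core list" where
  "core_list = [C0, C1, C2, C3, C4, C5, C6, C7]"

lemma in_core_list [simp]: "a \<in> set core_list"
  by (cases a) (auto simp: core_list_def)

lemma finite_core [simp]: "finite (S :: core set)"
  by (rule finite_subset[of _ "set core_list"]) auto

lemma card_core: "card (UNIV :: core set) = 8"
proof -
  have "(UNIV :: core set) = set core_list" by auto
  then have "card (UNIV :: core set) = length core_list"
    using distinct_card[of core_list] by (simp add: core_list_def)
  then show ?thesis by (simp add: core_list_def)
qed

lemma core_conbs_iff: "b \<in> set (core_conbs a) \<longleftrightarrow> a \<noteq> b \<and> b \<notin> set (core_nbs a)"
  by (cases a; cases b) auto

lemma core_nbs_sym: "b \<in> set (core_nbs a) \<longleftrightarrow> a \<in> set (core_nbs b)"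
  by (cases a; cases b) auto

lemma core_nbs_irrefl: "a \<notin> set (core_nbs a)"
  by (cases a) auto

lemma core_num_eq_iff [simp]: "core_num a = core_num b \<longleftrightarrow> a = b"
  by (cases a; cases b) auto

lemma core_num_less: "core_num a < 8"
  by (cases a) auto

lemma core_num_surj: "i < 8 \<Longrightarrow> \<exists>a. i = core_num a"
proof -
  assume "i < 8"
  then have "i \<in> set (map core_num core_list)" by (auto simp: core_list_def)
  then show ?thesis by auto
qed

definition isolates :: "(core \<Rightarrow> core list) \<Rightarrow> core list \<Rightarrow> core \<Rightarrow> core list \<Rightarrow> bool" where
  "isolates nb B w N \<longleftrightarrow> w \<in> set N \<and>
     (\<forall>x \<in> set N. x \<in> set B \<or> x = w \<or>
        (x \<notin> set (nb w) \<and> (\<forall>y \<in> set (nb x). y \<in> set B \<or> y \<notin> set (nb w))))"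

text \<open>
  An upper bound for one time step that only takes white paths of length at most two into account;
  the lists \<open>ext\<close> describe the neighborhoods of blue vertices outside the core.
\<close>

definition approx_step :: "(core \<Rightarrow> core list) \<Rightarrow> core list list \<Rightarrow> core list \<Rightarrow> core list" where
  "approx_step nb ext B = filter (\<lambda>w. w \<in> set B \<or> (\<exists>N \<in> set ext. isolates nb B w N) \<or>
     (\<exists>u \<in> set B. isolates nb B w (nb u))) core_list"

definition full :: "core list \<Rightarrow> bool" where
  "full B \<longleftrightarrow> (\<forall>a \<in> set core_list. a \<in> set B)"

definition core_sets :: "nat \<Rightarrow> core list list" where
  "core_sets k = filter (\<lambda>L. length L = k) (subseqs core_list)"

definition core_step :: "core list \<Rightarrow> core list" where
  "core_step = approx_step core_nbs []"

definition cocore_step :: "core list \<Rightarrow> core list" where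
  "cocore_step = approx_step core_conbs [[C0, C1, C2, C3, C4, C5, C6], core_list]"

lemma filter_in_subseqs: "filter P xs \<in> set (subseqs xs)"
  by (induction xs) (auto simp: Let_def)

text \<open>Smaller sets are enlarged to exactly \<open>k\<close> elements, so only one cardinality
  has to be enumerated.\<close>

lemma core_sets_cover:
  assumes "card S \<le> k" "k \<le> 8"
  shows "\<exists>L \<in> set (core_sets k). S \<subseteq> set L"
proof -
  obtain T where T: "S \<subseteq> T" "card T = k"
    using exists_subset_between[of S k UNIV] assms card_core by auto
  let ?L = "filter (\<lambda>a. a \<in> T) core_list"
  have "set ?L = T" by auto
  moreover have "distinct ?L" by (simp add: core_list_def)
  ultimately have "length ?L = k" using T distinct_card by metis
  moreover have "?L \<in> set (subseqs core_list)"
    by (rule filter_in_subseqs)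
  ultimately have "?L \<in> set (core_sets k)" by (simp add: core_sets_def)
  with T \<open>set ?L = T\<close> show ?thesis by blast
qed

text \<open>For starts without blue path vertices. The three levels serve the orders 8, 10 and 12,
  where a longer path forces \<open>C7\<close> to be blue earlier.\<close>

lemma core_triples:
  "\<forall>L \<in> set (core_sets 3). let s1 = core_step L; s2 = core_step s1 in
     \<not> full s2 \<and> (C7 \<in> set s1 \<longrightarrow> (let s3 = core_step s2 in
       \<not> full s3 \<and> (C7 \<in> set L \<longrightarrow> \<not> full (core_step s3))))"
  by code_simp

text \<open>For starts with blue path vertices: two core vertices get stuck after one step, and even
  when \<open>C7\<close> is then supplied by the path, four further steps are not enough.\<close>

lemma core_pairs:
  "\<forall>L \<in> set (core_sets 2). let s = core_step L in core_step s = s \<and> \<not> full s \<and>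
     \<not> full (core_step (core_step (core_step (core_step (C7 # s)))))"
  by code_simp

lemma cocore_triples:
  "\<forall>L \<in> set (core_sets 3). \<not> full (cocore_step (cocore_step L))"
  by code_simp

text \<open>The situation after a first step that colors only a white path vertex: its forcer in the
  core is then adjacent in \<open>tail_graph\<close> to all four white core vertices.\<close>

lemma cocore_quadruples:
  "\<forall>L \<in> set (core_sets 4). (\<exists>a \<in> set core_list. \<forall>x \<in> set core_list. x \<in> set L \<or> x \<in> set (core_nbs a)) \<longrightarrow>
     \<not> full (cocore_step L)"
  by code_simp

section \<open>A path attached to the core\<close>

context pair_graph
begin

lemma zero_force:
  assumes "u \<in> C" "(u, w) \<in> parcs G" "w \<notin> C" "\<And>x. (u, x) \<in> parcs G \<Longrightarrow> x \<in> C \<or> x = w"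
  shows "psd_force G C u w"
  unfolding psd_force_iff
proof (intro conjI ballI impI)
  show "w \<in> pverts G" using assms(2) by (rule in_arcsD2)
  fix x assume "x \<in> white_comp G C w" "(u, x) \<in> parcs G"
  then show "x = w" using assms(4) white_comp_disjoint by metis
qed (use assms in auto)

text \<open>Lets an explicit forcing sequence be verified from its end, one force at a time.\<close>

lemma psd_forcing_set_back:
  assumes "psd_forcing_set G (insert w C)" "psd_force G C u w"
  shows "psd_forcing_set G C"
proof -
  have "psd_color_change G C (insert w C)" using assms(2) by (auto simp: psd_color_change_def)
  with assms(1) show ?thesis
    unfolding psd_forcing_set_def by (meson converse_rtranclp_into_rtranclp insert_subset)
qed

end

text \<open>A white competitor within white distance two of \<open>w\<close> would lie in its
  component and block the force. Sources outside the core must be accounted for by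
  \<open>ext\<close>.\<close>

lemma approx_step_sound:
  assumes "pair_graph G"
    and nb: "\<And>a b. b \<in> set (nb a) \<longleftrightarrow> (core_num a, core_num b) \<in> parcs G"
    and L: "\<And>a. core_num a \<in> X \<Longrightarrow> a \<in> set L"
    and F: "psd_force G X u (core_num w)"
    and ext: "8 \<le> u \<Longrightarrow> w \<in> set L \<or>
      (\<exists>N \<in> set ext. w \<in> set N \<and> (\<forall>x \<in> set N. (u, core_num x) \<in> parcs G))"
  shows "w \<in> set (approx_step nb ext L)"
proof (cases "w \<in> set L")
  case True
  then show ?thesis by (simp add: approx_step_def)
next
  case False
  interpret pair_graph G by fact
  have w: "core_num w \<in> pverts G" "core_num w \<notin> X" "u \<in> X" "(u, core_num w) \<in> parcs G"
    and unique: "\<And>x. x \<in> white_comp G X (core_num w) \<Longrightarrow> (u, x) \<in> parcs G \<Longrightarrow> x = core_num w"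
    using F unfolding psd_force_iff by blast+
  have self: "core_num w \<in> white_comp G X (core_num w)" using w by (auto intro: white_comp.self)
  have step: "core_num y \<in> white_comp G X (core_num w)"
    if "core_num x \<in> white_comp G X (core_num w)" "y \<in> set (nb x)" "y \<notin> set L" for x y
    using that nb L white_comp.step[of "core_num x" G X "core_num w" "core_num y"] by blast
  have sym: "y \<in> set (nb x) \<longleftrightarrow> x \<in> set (nb y)" for x y using nb arc_sym by blast
  have iso: "isolates nb L w N" if N: "w \<in> set N" "\<forall>x \<in> set N. (u, core_num x) \<in> parcs G" for N
    unfolding isolates_def
  proof (intro conjI ballI)
    fix x assume x: "x \<in> set N"
    show "x \<in> set L \<or> x = w \<or> x \<notin> set (nb w) \<and> (\<forall>y\<in>set (nb x). y \<in> set L \<or> y \<notin> set (nb w))"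
    proof (rule ccontr)
      assume *: "\<not> ?thesis"
      then have "core_num x \<in> white_comp G X (core_num w)"
        using step[OF self] step[of _ x] sym by blast
      with unique N x have "core_num x = core_num w" by blast
      with * show False by simp
    qed
  qed (fact N)
  have "(\<exists>N \<in> set ext. isolates nb L w N) \<or> (\<exists>v \<in> set L. isolates nb L w (nb v))"
  proof (cases "8 \<le> u")
    case True
    with ext False iso show ?thesis by blast
  next
    case False
    then obtain v where v: "u = core_num v" using core_num_surj[of u] by auto
    with w L have "v \<in> set L" by blast
    moreover have "isolates nb L w (nb v)" by (rule iso) (use v w nb in auto)
    ultimately show ?thesis by blast
  qed
  then show ?thesis by (simp add: approx_step_def)
qed

text \<open>The path 7, 8, ..., n - 1 hangs on the core vertex 7; for \<open>n = 8\<close> there is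
  only the core.\<close>

definition tail_graph :: "nat \<Rightarrow> nat pair_pre_digraph" where
  "tail_graph n = \<lparr> pverts = {..<n},
     parcs = {(core_num a, core_num b) | a b. b \<in> set (core_nbs a)} \<union>
       {(i, j). i < n \<and> j < n \<and> (7 \<le> i \<and> j = Suc i \<or> 7 \<le> j \<and> i = Suc j)} \<rparr>"

lemma pverts_tail [simp]: "pverts (tail_graph n) = {..<n}"
  by (simp add: tail_graph_def)

lemma arc_tail_core: "(core_num a, core_num b) \<in> parcs (tail_graph n) \<longleftrightarrow> b \<in> set (core_nbs a)"
proof -
  have "\<not> (7 \<le> core_num a \<and> core_num b = Suc (core_num a) \<or> 7 \<le> core_num b \<and> core_num a = Suc (core_num b))"
    using core_num_less[of a] core_num_less[of b] by linarith
  then show ?thesis by (auto simp: tail_graph_def)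
qed

lemma arc_tail_iff:
  assumes "8 \<le> i"
  shows "(i, j) \<in> parcs (tail_graph n) \<longleftrightarrow> i < n \<and> j < n \<and> (j = Suc i \<or> i = Suc j)"
proof -
  have "i \<noteq> core_num a" for a using assms core_num_less[of a] by linarith
  then show ?thesis using assms by (auto simp: tail_graph_def)
qed

lemma arc_tail_7:
  assumes "(7, j) \<in> parcs (tail_graph n)"
  shows "j = 3 \<or> j = 4 \<or> j = 8"
proof (cases "j < 8")
  case True
  then obtain b where "j = core_num b" using core_num_surj by blast
  then have "b \<in> set (core_nbs C7)" using assms arc_tail_core[of C7 b n] by simp
  with \<open>j = core_num b\<close> show ?thesis by auto
next
  case False
  then have "j \<noteq> core_num b" for b using core_num_less[of b] by linarith
  then show ?thesis using assms by (auto simp: tail_graph_def)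
qed

lemma pair_graph_tail:
  assumes "8 \<le> n"
  shows "pair_graph (tail_graph n)"
proof (rule pair_graphI)
  fix x y assume "(x, y) \<in> parcs (tail_graph n)"
  then consider a b where "x = core_num a" "y = core_num b" "b \<in> set (core_nbs a)"
    | "x < n" "y < n" "7 \<le> x \<and> y = Suc x \<or> 7 \<le> y \<and> x = Suc y"
    by (auto simp: tail_graph_def)
  then show "x \<in> pverts (tail_graph n) \<and> y \<in> pverts (tail_graph n) \<and> x \<noteq> y \<and> (y, x) \<in> parcs (tail_graph n)"
  proof cases
    case 1
    then have "a \<noteq> b" using core_nbs_irrefl by blast
    moreover have "(y, x) \<in> parcs (tail_graph n)" using 1 core_nbs_sym arc_tail_core by simp
    ultimately show ?thesis using 1 assms core_num_less[of a] core_num_less[of b] by auto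
  next
    case 2
    then show ?thesis by (auto simp: tail_graph_def)
  qed
qed simp


lemma arc_tail_external:
  assumes "8 \<le> i" "8 \<le> n"
  shows "(i, core_num a) \<in> parcs (tail_graph n) \<longleftrightarrow> i = 8 \<and> 8 < n \<and> a = C7"
proof -
  have "core_num a = 7 \<longleftrightarrow> a = C7" by (cases a) auto
  then show ?thesis using arc_tail_iff[OF assms(1), of "core_num a" n] assms core_num_less[of a] by auto
qed

lemma core_arcs_tail:
  "(core_num a, j) \<in> parcs (tail_graph n) \<longleftrightarrow>
    j \<in> core_num ` set (core_nbs a) \<or> a = C7 \<and> j = 8 \<and> 8 < n"
proof (cases "j < 8")
  case True
  then obtain b where "j = core_num b" using core_num_surj by blast
  with True show ?thesis by (auto simp: arc_tail_core)
next
  case False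
  then have ne: "j \<noteq> core_num b" for b using core_num_less[of b] by linarith
  moreover have "core_num a = 7 \<longleftrightarrow> a = C7" by (cases a) auto
  ultimately show ?thesis
    using False core_num_less[of a] by (auto simp: tail_graph_def)
qed

section \<open>Upper bounds on the forcing numbers of the tail graph and its complement\<close>

lemma tail_forcing_number:
  assumes "8 \<le> n"
  shows "psd_forcing_number (tail_graph n) \<le> 3"
proof -
  let ?G = "tail_graph n"
  interpret pair_graph ?G using assms by (rule pair_graph_tail)
  have "psd_forcing_set ?G {..<k}" if "8 \<le> k" "k \<le> n" for k
    using that(2,1)
  proof (induction rule: inc_induct)
    case base
    show ?case using psd_forcing_set_verts by simp
  next
    case (step k)
    show ?case
    proof (rule psd_forcing_set_back)
      show "psd_forcing_set ?G (insert k {..<k})" using step by (simp add: lessThan_Suc)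
      show "psd_force ?G {..<k} (k - 1) k"
      proof (rule zero_force)
        show "(k - 1, k) \<in> parcs ?G" using step by (auto simp: tail_graph_def)
        fix x assume x: "(k - 1, x) \<in> parcs ?G"
        show "x \<in> {..<k} \<or> x = k"
        proof (cases "k = 8")
          case True
          with x show ?thesis using arc_tail_7[of x n] by auto
        next
          case False
          then have "8 \<le> k - 1" using step by simp
          with x step show ?thesis using arc_tail_iff[of "k - 1" x n] by auto
        qed
      qed (use step in auto)
    qed
  qed
  from this[of 8] assms have "psd_forcing_set ?G {..<8}" by simp
  \<comment> \<open>The set is written in reverse order of the forces: 2 forces 5, 1 forces 3, 0
    forces 6, 5 forces 4 and 3 forces 7. Then the path is colored from 8 onwards.\<close>
  moreover have "{..<8::nat} = {7,4,6,3,5,0,1,2}" by auto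
  ultimately have s: "psd_forcing_set ?G {7,4,6,3,5,0,1,2}" by simp
  have arcs: "(0, x) \<in> parcs ?G \<longleftrightarrow> x \<in> {1,3,6}" "(Suc 0, x) \<in> parcs ?G \<longleftrightarrow> x \<in> {0,2,3,5}"
    "(2, x) \<in> parcs ?G \<longleftrightarrow> x \<in> {1,5}" "(3, x) \<in> parcs ?G \<longleftrightarrow> x \<in> {0,1,4,5,7}"
    "(5, x) \<in> parcs ?G \<longleftrightarrow> x \<in> {1,2,3,4,6}" for x
    using core_arcs_tail[of C0 x n] core_arcs_tail[of C1 x n] core_arcs_tail[of C2 x n]
      core_arcs_tail[of C3 x n] core_arcs_tail[of C5 x n] by auto
  have "psd_forcing_set ?G {4,6,3,5,0,1,2}"
    by (rule psd_forcing_set_back[OF s zero_force[of 3]]) (auto simp: arcs)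
  then have "psd_forcing_set ?G {6,3,5,0,1,2}"
    by (rule psd_forcing_set_back[OF _ zero_force[of 5]]) (auto simp: arcs)
  then have "psd_forcing_set ?G {3,5,0,1,2}"
    by (rule psd_forcing_set_back[OF _ zero_force[of 0]]) (auto simp: arcs)
  then have "psd_forcing_set ?G {5,0,1,2}"
    by (rule psd_forcing_set_back[OF _ zero_force[of 1]]) (auto simp: arcs)
  then have "psd_forcing_set ?G {0,1,2}"
    by (rule psd_forcing_set_back[OF _ zero_force[of 2]]) (auto simp: arcs)
  from psd_forcing_number_le[OF this] show ?thesis by simp
qed

text \<open>Start with 0, 1, 2, 3, 6 white: 5 forces 0, 0 forces 2, 4 forces 1, 7 forces 6 and 6
  forces 3.\<close>

lemma cotail_forcing_number:
  assumes "8 \<le> n"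
  shows "psd_forcing_number (graph_complement (tail_graph n)) \<le> n - 5"
proof -
  let ?H = "graph_complement (tail_graph n)"
  interpret G: pair_graph "tail_graph n" using assms by (rule pair_graph_tail)
  interpret pair_graph ?H by (rule G.pair_graph_complement)
  define R where "R = {..<n} - {0,1,2,3,6}"
  have in_R: "x \<in> R \<longleftrightarrow> x < n \<and> x \<notin> {0,1,2,3,6}" for x by (auto simp: R_def)
  have arcs: "(0, x) \<in> parcs ?H \<longleftrightarrow> x < n \<and> x \<notin> {0,1,3,6}"
    "(4, x) \<in> parcs ?H \<longleftrightarrow> x < n \<and> x \<notin> {3,4,5,6,7}"
    "(5, x) \<in> parcs ?H \<longleftrightarrow> x < n \<and> x \<notin> {1,2,3,4,5,6}"
    "(6, x) \<in> parcs ?H \<longleftrightarrow> x < n \<and> x \<notin> {0,4,5,6}"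
    "(7, x) \<in> parcs ?H \<longleftrightarrow> x < n \<and> x \<notin> {3,4,7,8}" for x
    using assms core_arcs_tail[of C0 x n] core_arcs_tail[of C4 x n] core_arcs_tail[of C5 x n]
      core_arcs_tail[of C6 x n] core_arcs_tail[of C7 x n] by (auto simp: arcs_complement_iff)
  have "insert 3 (insert 6 (insert 1 (insert 2 (insert 0 R)))) = {..<n}"
    using assms by (auto simp: R_def)
  then have "psd_forcing_set ?H (insert 3 (insert 6 (insert 1 (insert 2 (insert 0 R)))))"
    using psd_forcing_set_verts by simp
  then have "psd_forcing_set ?H (insert 6 (insert 1 (insert 2 (insert 0 R))))"
    by (rule psd_forcing_set_back[OF _ zero_force[of 6]]) (use assms in \<open>auto simp: arcs in_R\<close>)
  then have "psd_forcing_set ?H (insert 1 (insert 2 (insert 0 R)))"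
    by (rule psd_forcing_set_back[OF _ zero_force[of 7]]) (use assms in \<open>auto simp: arcs in_R\<close>)
  then have "psd_forcing_set ?H (insert 2 (insert 0 R))"
    by (rule psd_forcing_set_back[OF _ zero_force[of 4]]) (use assms in \<open>auto simp: arcs in_R\<close>)
  then have "psd_forcing_set ?H (insert 0 R)"
    by (rule psd_forcing_set_back[OF _ zero_force[of 0]]) (use assms in \<open>auto simp: arcs in_R\<close>)
  then have "psd_forcing_set ?H R"
    by (rule psd_forcing_set_back[OF _ zero_force[of 5]]) (use assms in \<open>auto simp: arcs in_R\<close>)
  moreover have "card R = n - 5"
    unfolding R_def using assms by (subst card_Diff_subset) auto
  ultimately show ?thesis using psd_forcing_number_le by fastforce
qed

lemma core_step_sound:
  assumes "8 \<le> n" and L: "\<And>a. core_num a \<in> X \<Longrightarrow> a \<in> set L" and ext: "u = 8 \<Longrightarrow> C7 \<in> set L"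
    and F: "psd_force (tail_graph n) X u (core_num w)"
  shows "w \<in> set (core_step L)"
  unfolding core_step_def
proof (rule approx_step_sound[OF _ _ L F])
  interpret pair_graph "tail_graph n" using assms(1) by (rule pair_graph_tail)
  show "pair_graph (tail_graph n)" ..
  assume "8 \<le> u"
  with F assms(1) have "u = 8" "w = C7"
    using arc_tail_external[of u n w] unfolding psd_force_iff by blast+
  with ext show "w \<in> set L \<or> (\<exists>N \<in> set []. w \<in> set N \<and> (\<forall>x \<in> set N. (u, core_num x) \<in> parcs (tail_graph n)))"
    by simp
qed (simp_all add: arc_tail_core)

lemma core_step_mono: "set L \<subseteq> set (core_step L)"
  by (auto simp: core_step_def approx_step_def)

text \<open>Vertex 8 is the only outside neighbor of the core and sees only 7. If 7 is already blue
  or counted in \<open>L\<close> whenever 8 is blue, the path contributes nothing and the core may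
  be iterated alone.\<close>

lemma core_blue_approx:
  assumes "8 \<le> n" and L: "\<And>a. core_num a \<in> psd_blue (tail_graph n) B m \<Longrightarrow> a \<in> set L"
    and ext: "\<And>i. m \<le> i \<Longrightarrow> i < m + k \<Longrightarrow> 8 \<in> psd_blue (tail_graph n) B i \<Longrightarrow>
       7 \<in> psd_blue (tail_graph n) B i \<or> C7 \<in> set L"
  shows "core_num a \<in> psd_blue (tail_graph n) B (m + k) \<Longrightarrow> a \<in> set ((core_step ^^ k) L)"
  using ext
proof (induction k arbitrary: a)
  case 0
  then show ?case using L by simp
next
  case (Suc k)
  let ?X = "psd_blue (tail_graph n) B (m + k)" and ?L = "(core_step ^^ k) L"
  have IH: "core_num a \<in> ?X \<Longrightarrow> a \<in> set ?L" for a
    using Suc.IH Suc.prems(2) by simp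
  have "set L \<subseteq> set ((core_step ^^ j) L)" for j
    by (induction j) (use core_step_mono in auto)
  then have "C7 \<in> set ?L" if "8 \<in> ?X"
    using that Suc.prems(2)[of "m + k"] IH[of C7] by auto
  then have "w \<in> set (core_step ?L)" if "psd_force (tail_graph n) ?X u (core_num w)" for u w
    using core_step_sound[OF assms(1) IH _ that] that unfolding psd_force_def by blast
  with Suc.prems(1) IH core_step_mono[of ?L] show ?case by auto
qed

section \<open>Speed of propagation along the path\<close>

lemma tail_force_source:
  assumes "8 \<le> n" "psd_force (tail_graph n) X u j" "8 \<le> j"
  shows "u \<in> X \<and> (u = Suc j \<or> j = Suc u)"
proof -
  interpret pair_graph "tail_graph n" using assms(1) by (rule pair_graph_tail)
  have "u \<in> X" "(j, u) \<in> parcs (tail_graph n)"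
    using assms(2) arc_sym unfolding psd_force_iff by blast+
  then show ?thesis using arc_tail_iff[OF assms(3), of u n] by blast
qed

text \<open>With no blue path vertex at the start, color enters through 7 and advances at most one
  vertex per step. The first conjunct keeps the subtraction from being truncated.\<close>

lemma tail_blue_from_core:
  assumes "8 \<le> n" "B \<subseteq> {..<8}" "j \<in> psd_blue (tail_graph n) B i" "8 \<le> j"
  shows "j \<le> 7 + i \<and> 7 \<in> psd_blue (tail_graph n) B (7 + i - j)"
  using assms(3,4)
proof (induction i arbitrary: j)
  case 0
  then show ?case using assms(2) by auto
next
  case (Suc i)
  let ?b = "psd_blue (tail_graph n) B"
  interpret pair_graph "tail_graph n" using assms(1) by (rule pair_graph_tail)
  have up: "7 \<in> ?b (7 + Suc i - j)" if "7 \<in> ?b k" "k \<le> 7 + Suc i - j" for k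
    using that psd_blue_incseq[of k "7 + Suc i - j" B] by blast
  show ?case
  proof (cases "j \<in> ?b i")
    case True
    then show ?thesis using Suc.IH[OF True Suc.prems(2)] up[of "7 + i - j"] by auto
  next
    case False
    with Suc.prems obtain u where "psd_force (tail_graph n) (?b i) u j" by auto
    then have u: "u \<in> ?b i" "u = Suc j \<or> j = Suc u"
      using tail_force_source[OF assms(1) _ Suc.prems(2)] by auto
    show ?thesis
    proof (cases "8 \<le> u")
      case True
      then show ?thesis using Suc.IH[OF u(1) True] u(2) up[of "7 + i - u"] by auto
    next
      case False
      with u Suc.prems(2) have "j = 8" "u = 7" by auto
      with u show ?thesis by auto
    qed
  qed
qed

text \<open>A token is a path vertex that is blue at the start. As long as 7 is white, color reaches
  the vertices below \<open>p\<close> only by moving down from the tokens, at unit speed.\<close>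

lemma tail_blue_first_token:
  assumes "8 \<le> n" "\<And>j. j \<in> B \<Longrightarrow> 8 \<le> j \<Longrightarrow> p \<le> j" "j \<in> psd_blue (tail_graph n) B i" "8 \<le> j"
  shows "7 \<in> psd_blue (tail_graph n) B i \<or> p \<le> j + i"
  using assms(3,4)
proof (induction i arbitrary: j)
  case 0
  then show ?case using assms(2) by auto
next
  case (Suc i)
  let ?b = "psd_blue (tail_graph n) B"
  show ?case
  proof (cases "j \<in> ?b i")
    case True
    then show ?thesis using Suc.IH[OF True Suc.prems(2)] by auto
  next
    case False
    with Suc.prems obtain u where "psd_force (tail_graph n) (?b i) u j" by auto
    then have u: "u \<in> ?b i" "u = Suc j \<or> j = Suc u"
      using tail_force_source[OF assms(1) _ Suc.prems(2)] by auto
    show ?thesis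
    proof (cases "8 \<le> u")
      case True
      then show ?thesis using Suc.IH[OF u(1) True] u(2) by auto
    next
      case False
      with u Suc.prems(2) have "j = 8" "u = 7" by auto
      with u show ?thesis by auto
    qed
  qed
qed

lemma tail_blue_last_token:
  assumes "8 \<le> n" "8 \<le> p" "\<And>j. j \<in> B \<Longrightarrow> j \<le> p" "j \<in> psd_blue (tail_graph n) B i"
  shows "j \<le> p + i"
  using assms(4)
proof (induction i arbitrary: j)
  case 0
  then show ?case using assms(3) by auto
next
  case (Suc i)
  show ?case
  proof (cases "j \<in> psd_blue (tail_graph n) B i \<or> j < 8")
    case True
    then show ?thesis using Suc.IH[of j] assms(2) by auto
  next
    case False
    with Suc.prems obtain u where "psd_force (tail_graph n) (psd_blue (tail_graph n) B i) u j" by auto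
    from tail_force_source[OF assms(1) this] False Suc.IH[of u] show ?thesis by auto
  qed
qed

text \<open>Case split on the number of tokens. Without tokens the core or the far end is late; one
  token cannot be close both to the core and to the far end; two or more tokens leave too few
  vertices in the core.\<close>

lemma tail_blue_not_full:
  assumes n: "even n" "8 \<le> n" and B: "B \<subseteq> {..<n}" "card B \<le> 3"
  shows "psd_blue (tail_graph n) B (n div 2 - 2) \<noteq> {..<n}"
proof
  let ?b = "psd_blue (tail_graph n) B" and ?K = "n div 2 - 2"
  interpret pair_graph "tail_graph n" using n(2) by (rule pair_graph_tail)
  assume "?b ?K = {..<n}"
  then have final: "j \<in> ?b i" if "?K \<le> i" "j < n" for i j
    using that psd_blue_incseq[of ?K i B] by blast
  then have core_final: "core_num a \<in> ?b i" if "?K \<le> i" for i a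
    using that n core_num_less[of a] by simp
  have finB: "finite B" using B finite_subset by blast
  define D where "D = {a. core_num a \<in> B}"
  define P where "P = {j \<in> B. 8 \<le> j}"
  have "B = core_num ` D \<union> P"
  proof (rule set_eqI)
    fix j
    show "j \<in> B \<longleftrightarrow> j \<in> core_num ` D \<union> P"
      using core_num_surj[of j] by (cases "j < 8") (auto simp: D_def P_def)
  qed
  moreover have "core_num a \<notin> P" for a using core_num_less[of a] by (simp add: P_def)
  then have "core_num ` D \<inter> P = {}" by auto
  moreover have "finite P" using finB by (simp add: P_def)
  ultimately have "card B = card (core_num ` D) + card P"
    by (simp add: card_Un_disjoint)
  also have "card (core_num ` D) = card D" by (simp add: card_image inj_on_def)
  finally have card: "card D + card P \<le> 3" using B by simp
  show False
  proof (cases "P = {}")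
    case True
    then have core: "B \<subseteq> {..<8}" by (force simp: P_def)
    obtain L where L: "L \<in> set (core_sets 3)" "D \<subseteq> set L"
      using core_sets_cover[of D 3] card True by auto
    have approx: "a \<in> set ((core_step ^^ i) L)" if "core_num a \<in> ?b i" for a i
    proof -
      have "a \<in> set ((core_step ^^ i) L)" if "core_num a \<in> ?b (0 + i)"
      proof (rule core_blue_approx[OF n(2) _ _ that])
        show "a \<in> set L" if "core_num a \<in> ?b 0" for a
          using that L by (auto simp: D_def)
        show "7 \<in> ?b i \<or> C7 \<in> set L" if "8 \<in> ?b i" for i
          using tail_blue_from_core[OF n(2) core that] psd_blue_incseq[of "7 + i - 8" i B] by auto
      qed
      with that show ?thesis by simp
    qed
    have check: "\<not> full ((core_step ^^ 2) L)" "C7 \<in> set (core_step L) \<Longrightarrow> \<not> full ((core_step ^^ 3) L)"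
      "C7 \<in> set L \<Longrightarrow> \<not> full ((core_step ^^ 4) L)"
      using core_triples[rule_format, OF L(1)] core_step_mono[of L]
      by (auto simp: Let_def numeral_eq_Suc)
    have full: "full ((core_step ^^ i) L)" if "?K \<le> i" for i
      using approx core_final[OF that] by (simp add: full_def)
    show False
    proof (cases "n = 8")
      case True
      then show False using full[of 2] check by simp
    next
      case False
      \<comment> \<open>The far end is reached only through 7. This leaves \<open>n = 10\<close>
        with 7 blue at time 1 and \<open>n = 12\<close> with 7 blue at time 0.\<close>
      have "n - 1 \<in> ?b ?K" using final n by simp
      moreover have "8 \<le> n - 1" using False n(2) by simp
      ultimately have K: "n - 1 \<le> 7 + ?K" "7 \<in> ?b (7 + ?K - (n - 1))"
        using tail_blue_from_core[OF n(2) core] by blast+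
      obtain m where m: "n = 2 * m" using n by blast
      with K False n have "m = 5 \<or> m = 6" by auto
      then show False
      proof
        assume "m = 5"
        then show False using m K full[of 3] check approx[of C7 1] by simp
      next
        assume "m = 6"
        then show False using m K full[of 4] check approx[of C7 0] by simp
      qed
    qed
  next
    case False
    define p where "p = Min P"
    have p: "p \<in> P" "\<And>j. j \<in> P \<Longrightarrow> p \<le> j"
      unfolding p_def using False \<open>finite P\<close> by auto
    have first: "7 \<in> ?b i \<or> p \<le> j + i" if "j \<in> ?b i" "8 \<le> j" for i j
      using tail_blue_first_token[OF n(2) _ that, of p] p by (simp add: P_def)
    show False
    proof (cases "card P = 1")
      case True
      then obtain L where L: "L \<in> set (core_sets 2)" "D \<subseteq> set L"
        using core_sets_cover[of D 2] card by auto
      define s where "s = core_step L"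
      have s: "core_step s = s" "\<not> full ((core_step ^^ 4) (C7 # s))"
        using core_pairs[rule_format, OF L(1)] by (auto simp: s_def Let_def numeral_eq_Suc)
      have "D \<subseteq> set s" using L core_step_mono s_def by blast
      have stable: "(core_step ^^ i) s = s" for i by (induction i) (use s in auto)
      \<comment> \<open>The token at \<open>p\<close> needs \<open>m\<close> steps to reach 8; up to
        time \<open>m\<close> the core receives no help from the path.\<close>
      define m where "m = p - 8"
      have p8: "8 \<le> p" "p = m + 8" using p by (auto simp: P_def m_def)
      have early: "a \<in> set s" if "core_num a \<in> ?b m" for a
      proof -
        have "a \<in> set ((core_step ^^ m) s)" if "core_num a \<in> ?b (0 + m)"
        proof (rule core_blue_approx[OF n(2) _ _ that])
          show "a \<in> set s" if "core_num a \<in> ?b 0" for a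
            using that \<open>D \<subseteq> set s\<close> by (auto simp: D_def)
          show "7 \<in> ?b i \<or> C7 \<in> set s" if "8 \<in> ?b i" "i < 0 + m" for i
            using first[OF that(1)] that(2) p8 by auto
        qed
        with that stable show ?thesis by simp
      qed
      \<comment> \<open>In step \<open>Suc m\<close> the path can contribute at most the vertex 7,
        and the stuck core contributes nothing outside \<open>s\<close>.\<close>
      have "a \<in> set (C7 # s)" if a: "core_num a \<in> ?b (Suc m)" for a
      proof (cases "core_num a \<in> ?b m")
        case False
        with a obtain u where u: "psd_force (tail_graph n) (?b m) u (core_num a)" by auto
        show ?thesis
        proof (cases "8 \<le> u")
          case True
          then have "a = C7" using u arc_tail_external[of u n a] n unfolding psd_force_iff by blast
          then show ?thesis by simp
        next
          case False
          then have "a \<in> set (core_step s)" by (intro core_step_sound[OF n(2) early _ u]) auto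
          then show ?thesis using s by simp
        qed
      qed (use early in auto)
      then have "a \<in> set ((core_step ^^ 4) (C7 # s))" if "core_num a \<in> ?b (Suc m + 4)" for a
        by (rule core_blue_approx[OF n(2) _ _ that]) auto
      \<comment> \<open>Hence p < K + 3, while the far end requires n - 1 <= p + K < 2K + 3 = n -
        1.\<close>
      then have "\<not> ?K \<le> Suc m + 4" using s(2) core_final unfolding full_def by blast
      moreover have "n - 1 \<le> p + ?K"
      proof (rule tail_blue_last_token[OF n(2) p8(1)])
        have "P = {p}" using \<open>card P = 1\<close> p(1) card_1_singletonE by blast
        show "j \<le> p" if "j \<in> B" for j
        proof (cases "8 \<le> j")
          case True
          then have "j \<in> P" using that by (simp add: P_def)
          with \<open>P = {p}\<close> show ?thesis by simp
        qed (use p8 in simp)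
        show "n - 1 \<in> ?b ?K" using final n by simp
      qed
      moreover obtain l where "n = 2 * l" using n by blast
      ultimately show False using p8 by simp
    next
      case False
      moreover have "card P \<noteq> 0" using \<open>P \<noteq> {}\<close> \<open>finite P\<close> by simp
      ultimately have "card D \<le> 1" using card by simp
      \<comment> \<open>Counting 7 as blue from the start covers every contribution of the path, and
        the core still never fills.\<close>
      then have "card (insert C7 D) \<le> 2" by (simp add: card_insert_if)
      then obtain L where L: "L \<in> set (core_sets 2)" "insert C7 D \<subseteq> set L"
        using core_sets_cover[of "insert C7 D" 2] by auto
      define s where "s = core_step L"
      have s: "core_step s = s" "\<not> full s"
        using core_pairs[rule_format, OF L(1)] by (auto simp: s_def Let_def)
      have sub: "insert C7 D \<subseteq> set s" using L core_step_mono s_def by blast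
      have stable: "(core_step ^^ i) s = s" for i by (induction i) (use s in auto)
      have "a \<in> set ((core_step ^^ ?K) s)" for a
      proof (rule core_blue_approx[OF n(2), where m = 0])
        show "core_num a \<in> ?b (0 + ?K)" using core_final by simp
        show "a \<in> set s" if "core_num a \<in> ?b 0" for a
          using that sub by (auto simp: D_def)
      qed (use sub in auto)
      with stable s show False by (simp add: full_def)
    qed
  qed
qed

section \<open>Propagation in the complement of the tail graph\<close>

lemma arc_cotail_core:
  assumes "8 \<le> n"
  shows "(core_num a, core_num b) \<in> parcs (graph_complement (tail_graph n)) \<longleftrightarrow> b \<in> set (core_conbs a)"
  using assms core_num_less[of a] core_num_less[of b]
  by (auto simp: arcs_complement_iff arc_tail_core core_conbs_iff)

lemma cocore_step_sound:
  assumes "8 \<le> n" and L: "\<And>a. core_num a \<in> X \<Longrightarrow> a \<in> set L"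
    and F: "psd_force (graph_complement (tail_graph n)) X u (core_num w)"
  shows "w \<in> set (cocore_step L)"
  unfolding cocore_step_def
proof (rule approx_step_sound[OF _ _ L F])
  let ?H = "graph_complement (tail_graph n)"
  interpret G: pair_graph "tail_graph n" using assms(1) by (rule pair_graph_tail)
  interpret pair_graph ?H by (rule G.pair_graph_complement)
  show "pair_graph ?H" ..
  assume u: "8 \<le> u"
  have uw: "u < n" "(u, core_num w) \<notin> parcs (tail_graph n)"
    using F unfolding psd_force_iff arcs_complement_iff by auto
  have arc: "(u, core_num x) \<in> parcs ?H" if "u \<noteq> 8 \<or> x \<noteq> C7" for x
    using that u uw core_num_less[of x] arc_tail_external[OF u assms(1), of x]
    by (auto simp: arcs_complement_iff)
  have "\<exists>N \<in> set [[C0, C1, C2, C3, C4, C5, C6], core_list]. w \<in> set N \<and> (\<forall>x \<in> set N. (u, core_num x) \<in> parcs ?H)"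
  proof (cases "u = 8")
    case True
    with uw have "w \<noteq> C7" using arc_tail_external[OF u assms(1), of w] by auto
    then have "w \<in> set [C0, C1, C2, C3, C4, C5, C6]" by (cases w) auto
    moreover have "\<forall>x \<in> set [C0, C1, C2, C3, C4, C5, C6]. (u, core_num x) \<in> parcs ?H"
      by (intro ballI arc) auto
    ultimately show ?thesis by (meson list.set_intros(1))
  next
    case False
    then have "\<forall>x \<in> set core_list. (u, core_num x) \<in> parcs ?H" by (intro ballI arc) auto
    then show ?thesis by (meson in_core_list list.set_intros)
  qed
  then show "w \<in> set L \<or> (\<exists>N \<in> set [[C0, C1, C2, C3, C4, C5, C6], core_list].
      w \<in> set N \<and> (\<forall>x \<in> set N. (u, core_num x) \<in> parcs ?H))" ..
qed (simp add: arc_cotail_core assms(1))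

lemma cocore_step_mono: "set L \<subseteq> set (cocore_step L)"
  by (auto simp: cocore_step_def approx_step_def)

lemma cocore_blue_approx:
  assumes "8 \<le> n" and L: "\<And>a. core_num a \<in> X \<Longrightarrow> a \<in> set L"
    and "core_num a \<in> psd_blue (graph_complement (tail_graph n)) X k"
  shows "a \<in> set ((cocore_step ^^ k) L)"
  using assms(3)
proof (induction k arbitrary: a)
  case 0
  then show ?case using L by simp
next
  case (Suc k)
  then show ?case
    using cocore_step_sound[OF assms(1) Suc.IH] cocore_step_mono[of "(cocore_step ^^ k) L"] by auto
qed

lemma core_white_card:
  assumes "S \<subseteq> {..<8}"
  shows "card {a. core_num a \<notin> S} = 8 - card S"
proof -
  have "S = core_num ` {a. core_num a \<in> S}"
    using core_num_surj[OF lessThan_iff[THEN iffD1, OF subsetD[OF assms]]] by (auto simp: image_iff)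
  then have "card S = card {a. core_num a \<in> S}"
    using card_image[of core_num "{a. core_num a \<in> S}"] by (simp add: inj_on_def)
  moreover have "{a. core_num a \<notin> S} = UNIV - {a. core_num a \<in> S}" by auto
  ultimately show ?thesis by (simp add: card_Diff_subset card_core)
qed

text \<open>In the complement \<open>p\<close> misses only its neighbors on the path. These are
  linked to \<open>p\<close> through the other white vertices in \<open>T\<close>, each of which is
  joined to \<open>p\<close> directly.\<close>

lemma cotail_white_connected:
  assumes "8 \<le> n" and S: "S \<subseteq> {..<n}" "card S = 5" and p: "p \<in> S" "8 \<le> p" and "s \<in> S"
  shows "s \<in> white_comp (graph_complement (tail_graph n)) ({..<n} - S) p"
proof -
  let ?H = "graph_complement (tail_graph n)" and ?C = "white_comp (graph_complement (tail_graph n)) ({..<n} - S) p"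
  interpret G: pair_graph "tail_graph n" using assms(1) by (rule pair_graph_tail)
  have self: "p \<in> ?C" using p S by (intro white_comp.self) auto
  have step: "y \<in> ?C" if "x \<in> ?C" "x \<in> S" "y \<in> S" "x \<noteq> y" "(y, x) \<notin> parcs (tail_graph n)" for x y
  proof (rule white_comp.step[OF that(1)])
    show "(x, y) \<in> parcs ?H" using that S G.arc_sym[of x y] by (auto simp: arcs_complement_iff)
  qed (use that in simp)
  have direct: "y \<in> ?C" if "y \<in> S" "y \<noteq> Suc p" "p \<noteq> Suc y" for y
    using that step[OF self p(1), of y] self G.arc_sym[of y p] arc_tail_iff[OF p(2), of y n] by blast
  define T where "T = S - {p, Suc p, p - 1}"
  have "card {p, Suc p, p - 1} \<le> 3" by (simp add: card_insert_if)
  then have T2: "2 \<le> card T"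
    using S diff_card_le_card_Diff[of "{p, Suc p, p - 1}" S] by (simp add: T_def)
  have T: "t \<in> ?C" "t \<in> S" if "t \<in> T" for t using that direct[of t] p by (auto simp: T_def)
  have via: "y \<in> ?C" if y: "y \<in> S" "y \<notin> T" and bad: "\<And>t. t \<in> T \<Longrightarrow> (y, t) \<in> parcs (tail_graph n) \<Longrightarrow> t = z" for y z
  proof -
    have "T \<noteq> {z}" "T \<noteq> {}" using T2 by auto
    then obtain t where t: "t \<in> T" "t \<noteq> z" by blast
    with bad have "(y, t) \<notin> parcs (tail_graph n)" by blast
    moreover have "t \<noteq> y" using t y by blast
    ultimately show ?thesis using step[OF T[OF t(1)] y(1)] by blast
  qed
  have succ: "Suc p \<in> ?C" if "Suc p \<in> S"
    by (rule via[of _ "Suc (Suc p)"]) (use that p arc_tail_iff[of "Suc p" _ n] in \<open>auto simp: T_def\<close>)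
  show ?thesis
  proof (cases "s = Suc p \<or> p = Suc s")
    case False
    then show ?thesis using direct \<open>s \<in> S\<close> by blast
  next
    case True
    then consider "s = Suc p" | "p = Suc s" "8 \<le> s" | "p = 8" "s = 7" using p by linarith
    then show ?thesis
    proof cases
      case 1
      then show ?thesis using succ \<open>s \<in> S\<close> by simp
    next
      case 2
      then show ?thesis
        by (intro via[of _ "s - 1"]) (use \<open>s \<in> S\<close> arc_tail_iff[of s _ n] in \<open>auto simp: T_def\<close>)
    next
      case 3
      show ?thesis
      proof (cases "9 \<in> S")
        case True
        then have "9 \<in> ?C" using succ 3 by simp
        moreover have "(7, 9) \<notin> parcs (tail_graph n)" using arc_tail_7[of 9 n] by auto
        ultimately show ?thesis using step[OF _ True \<open>s \<in> S\<close>] 3 by simp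
      next
        case False
        \<comment> \<open>Vertex 7 may miss both 3 and 4, so a third element of \<open>T\<close> is
          needed; it exists because 9 is not in \<open>S\<close>.\<close>
        then have "T = S - {8, 7}" using 3 by (auto simp: T_def)
        then have "3 \<le> card T" using S diff_card_le_card_Diff[of "{8, 7}" S] by simp
        moreover have "card {3, 4 :: nat} = 2" by simp
        ultimately have "\<not> T \<subseteq> {3, 4}" using card_mono[of "{3, 4 :: nat}" T] by auto
        then obtain t where t: "t \<in> T" "t \<noteq> 3" "t \<noteq> 4" by blast
        with 3 have "(7, t) \<notin> parcs (tail_graph n)" using arc_tail_7[of t n] by (auto simp: T_def)
        moreover have "t \<noteq> 7" using t 3 by (simp add: T_def)
        ultimately show ?thesis using step[OF T[OF t(1)] \<open>s \<in> S\<close>] 3 by simp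
      qed
    qed
  qed
qed

text \<open>Neighbors of a path vertex have degree at most three in the tail graph: two on the path,
  three at the attachment vertex 7.\<close>

lemma tail_degree:
  assumes "8 \<le> p" "(p, u) \<in> parcs (tail_graph n)" "\<And>x. x \<in> T \<Longrightarrow> (u, x) \<in> parcs (tail_graph n)"
  shows "card T \<le> 3"
proof (cases "8 \<le> u")
  case True
  have "x \<in> {Suc u, u - 1}" if "x \<in> T" for x
    using assms(3)[OF that] arc_tail_iff[OF True, of x n] by auto
  then have "T \<subseteq> {Suc u, u - 1}" by (rule subsetI)
  then have "card T \<le> card {Suc u, u - 1}" by (intro card_mono) auto
  also have "\<dots> \<le> 3" by (simp add: card_insert_if)
  finally show ?thesis .
next
  case False
  then have "u = 7" using assms arc_tail_iff[of p u n] by auto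
  then have "T \<subseteq> {3, 4, 8}" using assms(3) arc_tail_7 by blast
  then have "card T \<le> card {3, 4, 8 :: nat}" by (intro card_mono) auto
  then show ?thesis by simp
qed

text \<open>Five white vertices inside the core are excluded by \<open>cocore_triples\<close>.
  Otherwise they form one component, so a forcer misses the other four in the complement. This
  restricts the first step to a single path vertex, and \<open>cocore_quadruples\<close> excludes
  the second.\<close>

lemma cotail_blue_not_full:
  assumes n: "8 \<le> n" and B: "B \<subseteq> {..<n}" "card B \<le> n - 5"
  shows "psd_blue (graph_complement (tail_graph n)) B 2 \<noteq> {..<n}"
proof
  let ?H = "graph_complement (tail_graph n)"
  interpret G: pair_graph "tail_graph n" using n by (rule pair_graph_tail)
  interpret pair_graph ?H by (rule G.pair_graph_complement)
  assume full: "psd_blue ?H B 2 = {..<n}"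
  have "card ({..<n} - B) = n - card B" using B by (subst card_Diff_subset) (auto intro: finite_subset)
  then have "5 \<le> card ({..<n} - B)" using B n by simp
  \<comment> \<open>Coloring all but five white vertices can only speed up the process, so exactly
    five may be assumed white.\<close>
  then obtain S where S: "S \<subseteq> {..<n} - B" "card S = 5"
    by (rule obtain_subset_with_card_n)
  define X where "X = {..<n} - S"
  have "B \<subseteq> psd_blue ?H X 0" using B S by (auto simp: X_def)
  from psd_blue_mono[OF this, of 2] have "psd_blue ?H B 2 \<subseteq> psd_blue ?H X 2"
    unfolding add_0 .
  then have final: "j \<in> psd_blue ?H X 2" if "j < n" for j using full that by auto
  have SV: "S \<subseteq> {..<n}" using S by blast
  have fin: "finite S" using SV finite_subset by blast
  show False
  proof (cases "S \<subseteq> {..<8}")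
    case True
    have "{a. core_num a \<in> X} \<subseteq> {a. core_num a \<notin> S}" by (auto simp: X_def)
    moreover obtain L where L: "L \<in> set (core_sets 3)" "{a. core_num a \<notin> S} \<subseteq> set L"
      using core_sets_cover[of "{a. core_num a \<notin> S}" 3] core_white_card[OF True] S by auto
    ultimately have "a \<in> set ((cocore_step ^^ 2) L)" for a
      using n core_num_less[of a] by (intro cocore_blue_approx[OF n _ final]) auto
    then have "full (cocore_step (cocore_step L))" by (simp add: full_def numeral_2_eq_2)
    with cocore_triples L show False by blast
  next
    case False
    then obtain p where p: "p \<in> S" "8 \<le> p" by fastforce
    have conn: "white_comp ?H X w = white_comp ?H X q" "S \<subseteq> white_comp ?H X w"
      if "w \<in> S" "q \<in> S" "8 \<le> q" for w q
      using that cotail_white_connected[OF n SV S(2), of q] white_comp_eq[of w X q] unfolding X_def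
      by auto
    have adj: "(u, x) \<in> parcs (tail_graph n)" if "psd_force ?H X u w" "x \<in> S" "x \<noteq> w" for u w x
    proof -
      have "u \<in> X" "w \<in> S" "u < n" and only: "\<forall>x \<in> white_comp ?H X w. (u, x) \<in> parcs ?H \<longrightarrow> x = w"
        using that(1) unfolding psd_force_iff X_def by auto
      then have "(u, x) \<notin> parcs ?H" using conn(2)[of w p] p that by blast
      then show ?thesis
        using that SV \<open>u \<in> X\<close> \<open>u < n\<close> by (auto simp: arcs_complement_iff X_def)
    qed
    \<comment> \<open>If another vertex were forced while a path vertex \<open>q\<close> is white,
      the forcer would be a tail-graph neighbor of \<open>q\<close> and adjacent to four white
      vertices, contradicting \<open>tail_degree\<close>. So all first-step forces hit the same
      unique white path vertex.\<close>
    have first: "w = q" if F: "psd_force ?H X u w" and q: "q \<in> S" "8 \<le> q" for u w q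
    proof (rule ccontr)
      assume "w \<noteq> q"
      then have "(q, u) \<in> parcs (tail_graph n)" using adj[OF F] q G.arc_sym by blast
      then have "card (S - {w}) \<le> 3" using adj[OF F] by (intro tail_degree[OF q(2)]) auto
      then show False using S(2) fin by (simp add: card_Diff_singleton_if split: if_splits)
    qed
    have "\<exists>u w. psd_force ?H X u w"
    proof (rule ccontr)
      assume "\<not> ?thesis"
      then have "psd_blue ?H X 2 = X" by (simp add: numeral_2_eq_2)
      with final p SV show False by (auto simp: X_def)
    qed
    then obtain u where u: "psd_force ?H X u p" using first[OF _ p] by blast
    have core: "S - {p} \<subseteq> {..<8}"
      using first[OF u] by fastforce
    have card4: "card (S - {p}) = 4" using S(2) p by simp
    \<comment> \<open>A path vertex has at most the core neighbor 7, but four white core vertices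
      are needed.\<close>
    have "u < 8"
    proof (rule ccontr)
      assume "\<not> u < 8"
      then have "S - {p} \<subseteq> {7}"
        using adj[OF u] core arc_tail_iff[of u _ n] by fastforce
      then have "card (S - {p}) \<le> card {7 :: nat}" by (intro card_mono) auto
      with card4 show False by simp
    qed
    then obtain a where a: "u = core_num a" using core_num_surj by blast
    obtain L where L: "L \<in> set (core_sets 4)" "{b. core_num b \<notin> S - {p}} \<subseteq> set L"
      using core_sets_cover[of "{b. core_num b \<notin> S - {p}}" 4] core_white_card[OF core] card4 by auto
    have "x \<in> set L \<or> x \<in> set (core_nbs a)" for x
      using L(2) adj[OF u, of "core_num x"] a arc_tail_core[of a x n] by blast
    then have not_full: "\<not> full (cocore_step L)"
      using cocore_quadruples L(1) by (meson in_core_list)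
    have "psd_blue ?H X 1 \<subseteq> insert p X" using first[OF _ p] by auto
    then have L1: "b \<in> set L" if "core_num b \<in> psd_blue ?H X 1" for b
      using that L(2) p core_num_less[of b] by (auto simp: X_def)
    have two: "psd_blue ?H X 2 = psd_blue ?H (psd_blue ?H X 1) 1" by (simp add: numeral_2_eq_2)
    have "b \<in> set ((cocore_step ^^ 1) L)" for b
    proof (rule cocore_blue_approx[OF n L1])
      show "core_num b \<in> psd_blue ?H (psd_blue ?H X 1) 1"
        unfolding two[symmetric] by (rule final) (use n core_num_less[of b] in simp)
    qed
    with not_full show False by (simp add: full_def)
  qed
qed

section \<open>The sum of the propagation times\<close>

context pair_graph
begin

lemma psd_stuck_forcing_set:
  assumes "psd_forcing_set G B" "\<And>u w. \<not> psd_force G B u w"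
  shows "B = pverts G"
proof -
  have "psd_blue G B t = B" for t by (induction t) (use assms(2) in auto)
  with assms(1) show ?thesis by (auto simp: psd_forcing_set_iff)
qed

text \<open>Time zero would require every forcing set to contain all vertices, but one end of an
  edge may be left out and forced by the other.\<close>

lemma psd_prop_time_pos:
  assumes "(x, y) \<in> parcs G"
  shows "1 \<le> psd_prop_time G"
proof (rule ccontr)
  assume "\<not> 1 \<le> psd_prop_time G"
  then have "psd_prop_time G = 0" by simp
  then have card: "card (pverts G) = psd_forcing_number G"
    using psd_prop_time_attained by auto
  have xy: "x \<in> pverts G" "y \<in> pverts G" "x \<noteq> y" using assms in_arcsD1 in_arcsD2 no_loop by blast+
  have "psd_forcing_set G (pverts G - {y})"
  proof (rule psd_forcing_set_back)
    show "psd_forcing_set G (insert y (pverts G - {y}))"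
      using xy psd_forcing_set_verts by (simp add: insert_absorb)
    show "psd_force G (pverts G - {y}) x y"
      by (rule zero_force) (use xy assms in_arcsD2 in auto)
  qed
  from psd_forcing_number_le[OF this] card card_Diff1_less[OF pair_finite_verts xy(2)]
  show False by simp
qed

theorem psd_prop_time_complement_bounds:
  assumes "2 \<le> card (pverts G)"
  shows "1 \<le> psd_prop_time G + psd_prop_time (graph_complement G)"
    and "2 * (psd_prop_time G + psd_prop_time (graph_complement G)) \<le> card (pverts G) + 4"
proof -
  interpret H: pair_graph "graph_complement G" by (rule pair_graph_complement)
  obtain x y where "x \<in> pverts G" "y \<in> pverts G" "x \<noteq> y"
    using assms card_le_Suc0_iff_eq[OF pair_finite_verts] by fastforce
  then have "(x, y) \<in> parcs G \<or> (x, y) \<in> parcs (graph_complement G)"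
    by (auto simp: arcs_complement_iff)
  then show "1 \<le> psd_prop_time G + psd_prop_time (graph_complement G)"
    using psd_prop_time_pos H.psd_prop_time_pos by (meson le_add1 le_add2 le_trans)
  \<comment> \<open>Twice the sum of the times is at most 2(n + 1) minus the sum of the forcing
    numbers, which is at least n - 2.\<close>
  show "2 * (psd_prop_time G + psd_prop_time (graph_complement G)) \<le> card (pverts G) + 4"
    using psd_prop_time_bound H.psd_prop_time_bound psd_forcing_number_complement by simp
qed

end

section \<open>Graphs attaining the two bounds\<close>

lemma edgeless_prop_time:
  fixes n :: nat
  assumes "2 \<le> n" and G: "G = \<lparr>pverts = {..<n}, parcs = {}\<rparr>"
  shows "pair_graph G" "psd_prop_time G + psd_prop_time (graph_complement G) = 1"
proof -
  have V: "pverts G = {..<n}" "parcs G = {}" by (simp_all add: G)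
  show "pair_graph G" by (rule pair_graphI) (auto simp: V)
  then interpret pair_graph G .
  interpret H: pair_graph "graph_complement G" by (rule pair_graph_complement)
  obtain B where B: "psd_forcing_set G B" "card B = psd_forcing_number G"
    using psd_forcing_number_attained by blast
  then have "B = pverts G" by (intro psd_stuck_forcing_set) (auto simp: psd_force_iff V)
  with B have "psd_prop_time G \<le> 0" by (intro psd_prop_time_le[of B]) auto
  moreover have "psd_prop_time (graph_complement G) \<le> 1"
  proof (rule ccontr)
    assume "\<not> ?thesis"
    \<comment> \<open>Time at least two leaves at least three white vertices. In the complete graph
      they form one component seen by every blue vertex, so nothing can be forced.\<close>
    then have small: "psd_forcing_number (graph_complement G) + 3 \<le> n"
      using H.psd_prop_time_bound by (simp add: V)
    obtain C where C: "psd_forcing_set (graph_complement G) C"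
        "card C = psd_forcing_number (graph_complement G)"
      using H.psd_forcing_number_attained by blast
    have "C \<subseteq> {..<n}" using C by (simp add: psd_forcing_set_def V)
    then have "card ({..<n} - C) = n - card C"
      by (subst card_Diff_subset) (auto intro: finite_subset)
    then have white: "\<not> card ({..<n} - C) \<le> Suc 0" using small C by simp
    have "\<not> psd_force (graph_complement G) C u w" for u w
    proof
      assume F: "psd_force (graph_complement G) C u w"
      obtain x where x: "x < n" "x \<notin> C" "x \<noteq> w"
        using white card_le_Suc0_iff_eq[of "{..<n} - C"] by auto
      have w: "w < n" "w \<notin> C" "u \<in> C" "u < n"
        using F H.in_arcsD1[of u w] unfolding H.psd_force_iff by (auto simp: V)
      have "w \<in> white_comp (graph_complement G) C w" using w by (auto intro: white_comp.self simp: V)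
      then have "x \<in> white_comp (graph_complement G) C w"
        by (rule white_comp.step) (use x w in \<open>auto simp: arcs_complement_iff V\<close>)
      moreover have "(u, x) \<in> parcs (graph_complement G)"
        using x w by (auto simp: arcs_complement_iff V)
      ultimately show False using F x unfolding H.psd_force_iff by blast
    qed
    then have "C = {..<n}" using H.psd_stuck_forcing_set[OF C(1)] by (simp add: V)
    with small C(2) show False by simp
  qed
  moreover have "1 \<le> psd_prop_time G + psd_prop_time (graph_complement G)"
    by (rule psd_prop_time_complement_bounds) (use assms in \<open>simp add: V\<close>)
  ultimately show "psd_prop_time G + psd_prop_time (graph_complement G) = 1" by simp
qed

text \<open>The lower bounds n/2 - 1 for the graph and 3 for its complement add up exactly to the
  general upper bound.\<close>

lemma tail_prop_time:
  assumes "even n" "8 \<le> n"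
  shows "2 * (psd_prop_time (tail_graph n) + psd_prop_time (graph_complement (tail_graph n))) = n + 4"
proof -
  let ?G = "tail_graph n" and ?H = "graph_complement (tail_graph n)"
  interpret G: pair_graph ?G using assms(2) by (rule pair_graph_tail)
  interpret H: pair_graph ?H by (rule G.pair_graph_complement)
  obtain B where B: "psd_forcing_set ?G B" "card B = psd_forcing_number ?G"
      "psd_blue ?G B (psd_prop_time ?G) = {..<n}"
    using G.psd_prop_time_attained by auto
  have BV: "B \<subseteq> {..<n}" using B(1) by (simp add: psd_forcing_set_def)
  have "\<not> psd_prop_time ?G \<le> n div 2 - 2"
  proof
    assume "psd_prop_time ?G \<le> n div 2 - 2"
    from G.psd_blue_incseq[OF this, of B] B(3) G.psd_blue_subset[of B "n div 2 - 2"] BV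
    have "psd_blue ?G B (n div 2 - 2) = {..<n}" by auto
    moreover have "card B \<le> 3" using B(2) tail_forcing_number[OF assms(2)] by simp
    ultimately show False using tail_blue_not_full[OF assms BV] by blast
  qed
  moreover obtain C where C: "psd_forcing_set ?H C" "card C = psd_forcing_number ?H"
      "psd_blue ?H C (psd_prop_time ?H) = {..<n}"
    using H.psd_prop_time_attained by auto
  have CV: "C \<subseteq> {..<n}" using C(1) by (simp add: psd_forcing_set_def)
  have "\<not> psd_prop_time ?H \<le> 2"
  proof
    assume "psd_prop_time ?H \<le> 2"
    from H.psd_blue_incseq[OF this, of C] C(3) H.psd_blue_subset[of C 2] CV
    have "psd_blue ?H C 2 = {..<n}" by auto
    moreover have "card C \<le> n - 5" using C(2) cotail_forcing_number[OF assms(2)] by simp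
    ultimately show False using cotail_blue_not_full[OF assms(2) CV] by blast
  qed
  moreover have "2 * (psd_prop_time ?G + psd_prop_time ?H) \<le> n + 4"
    using G.psd_prop_time_complement_bounds(2) assms by simp
  moreover obtain m where "n = 2 * m" using assms by blast
  ultimately show ?thesis using assms(2) by simp
qed

theorem theorem4p5:
  shows "(\<forall>(n::nat) (G :: 'a pair_pre_digraph).
            pair_graph G \<and> card (pverts G) = n \<and> n \<ge> 2 \<longrightarrow>
              1 \<le> psd_prop_time G + psd_prop_time (graph_complement G) \<and>
              real (psd_prop_time G + psd_prop_time (graph_complement G)) \<le> real n / 2 + 2)
       \<and> (\<forall>n::nat. n \<ge> 2 \<longrightarrow>
            (\<exists>G :: nat pair_pre_digraph. pair_graph G \<and> card (pverts G) = n \<and>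
               psd_prop_time G + psd_prop_time (graph_complement G) = 1))
       \<and> (\<forall>n::nat. even n \<and> n \<ge> 8 \<longrightarrow>
            (\<exists>G :: nat pair_pre_digraph. pair_graph G \<and> card (pverts G) = n \<and>
               real (psd_prop_time G + psd_prop_time (graph_complement G)) = real n / 2 + 2))"
proof (intro conjI allI impI)
  fix n :: nat and G :: "'a pair_pre_digraph"
  assume G: "pair_graph G \<and> card (pverts G) = n \<and> n \<ge> 2"
  then have "2 \<le> card (pverts G)" by simp
  note bounds = pair_graph.psd_prop_time_complement_bounds[OF conjunct1[OF G] this]
  show "1 \<le> psd_prop_time G + psd_prop_time (graph_complement G)" by (fact bounds(1))
  show "real (psd_prop_time G + psd_prop_time (graph_complement G)) \<le> real n / 2 + 2"
  proof -
    have "2 * (psd_prop_time G + psd_prop_time (graph_complement G)) \<le> n + 4"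
      using bounds(2) G by simp
    then have "real (2 * (psd_prop_time G + psd_prop_time (graph_complement G))) \<le> real (n + 4)"
      by (simp only: of_nat_le_iff)
    then show ?thesis by simp
  qed
next
  fix n :: nat assume "n \<ge> 2"
  from edgeless_prop_time[OF this refl]
  show "\<exists>G :: nat pair_pre_digraph. pair_graph G \<and> card (pverts G) = n \<and>
      psd_prop_time G + psd_prop_time (graph_complement G) = 1"
    by (intro exI[of _ "\<lparr>pverts = {..<n}, parcs = {}\<rparr>"]) simp
next
  fix n :: nat assume n: "even n \<and> n \<ge> 8"
  then have "2 * (psd_prop_time (tail_graph n) + psd_prop_time (graph_complement (tail_graph n))) = n + 4"
    by (intro tail_prop_time) auto
  then have "real (2 * (psd_prop_time (tail_graph n) + psd_prop_time (graph_complement (tail_graph n))))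
      = real (n + 4)"
    by (simp only: of_nat_eq_iff)
  then have "real (psd_prop_time (tail_graph n) + psd_prop_time (graph_complement (tail_graph n)))
      = real n / 2 + 2"
    by simp
  then show "\<exists>G :: nat pair_pre_digraph. pair_graph G \<and> card (pverts G) = n \<and>
      real (psd_prop_time G + psd_prop_time (graph_complement G)) = real n / 2 + 2"
    using pair_graph_tail n by (intro exI[of _ "tail_graph n"]) simp
qed

end
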